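(* Let $T$ be a pruned tree having an uncountable ray. Then the following are equivalent for a tree $T'$: (a) $\mathcal R(T')$ is discrete. (b) $\mathcal R(T)\times\mathcal R(T')$ is a ray space.
   Context: A tree is a partially ordered set $(T,\le)$ with a minimum (its root) such that $\{s\in T:s\le t\}$ is well-ordered for every $t\in T$. It is pruned if it has no maximal elements. A ray of $T$ is a non-empty downward closed chain of $T$ with no maximal element; $\mathcal R(T)$ is the set of all rays with the subspace topology inherited from the power set $\mathcal P(T)\simeq2^T$ (product topology). A space is a ray space if it is homeomorphic to $\mathcal R(S)$ for some tree $S$. *)

theory Defs
  imports "HOL-Analysis.Analysis"
begin

text \<open>
  A partially ordered set is given by its non-strict order relation \<open>r\<close>; as \<open>r\<close> is
  reflexive, the underlying set is \<open>Field r\<close>, and \<open>under r t\<close> is the set of all \<open>s \<le> t\<close>.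
\<close>

definition is_tree :: "'a rel \<Rightarrow> bool" where
  "is_tree r \<longleftrightarrow>
     partial_order_on (Field r) r \<and>
     (\<exists>m\<in>Field r. \<forall>t\<in>Field r. (m, t) \<in> r) \<and>
     (\<forall>t\<in>Field r. well_order_on (under r t) (Restr r (under r t)))"

definition pruned :: "'a rel \<Rightarrow> bool" where
  "pruned r \<longleftrightarrow> (\<forall>s\<in>Field r. \<exists>t\<in>Field r. (s, t) \<in> r \<and> s \<noteq> t)"

definition rays :: "'a rel \<Rightarrow> 'a set set" where
  "rays r = {x. x \<noteq> {} \<and> ofilter r x \<and> x \<in> Chains r \<and> (\<forall>s\<in>x. \<exists>t\<in>x. (s, t) \<in> r \<and> s \<noteq> t)}"

text \<open>The topology on \<open>Pow A\<close> making characteristic functions a homeomorphism onto \<open>2\<^sup>A\<close>.\<close>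

definition powerset_topology :: "'a set \<Rightarrow> 'a set topology" where
  "powerset_topology A =
     pullback_topology (Pow A) (\<lambda>x. restrict (\<lambda>t. t \<in> x) A)
       (product_topology (\<lambda>_. discrete_topology (UNIV :: bool set)) A)"

definition ray_topology :: "'a rel \<Rightarrow> 'a set topology" where
  "ray_topology r = subtopology (powerset_topology (Field r)) (rays r)"

text \<open>
  HOL cannot quantify existentially over the type carrying the tree, so the definition fixes
  the type \<open>'x \<times> nat\<close>. This is no restriction: by \<open>ray_spaceI\<close> below, a tree on any type
  whatsoever may serve as the witness.
\<close>

definition ray_space :: "'x topology \<Rightarrow> bool" where
  "ray_space X \<longleftrightarrow> (\<exists>S :: ('x \<times> nat) rel. is_tree S \<and> X homeomorphic_space ray_topology S)"


subsection \<open>Basic properties of the topology\<close>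

lemma topspace_powerset_topology [simp]: "topspace (powerset_topology A) = Pow A"
  by (auto simp: powerset_topology_def topspace_pullback_topology)

lemma rays_subset: "rays r \<subseteq> Pow (Field r)"
  by (auto simp: rays_def ofilter_def)

lemma topspace_ray_topology [simp]: "topspace (ray_topology r) = rays r"
  using rays_subset[of r] by (auto simp: ray_topology_def)

lemma continuous_map_into_ray_topology:
  assumes "f \<in> topspace X \<rightarrow> rays r"
    and "\<And>t. t \<in> Field r \<Longrightarrow> continuous_map X (discrete_topology UNIV) (\<lambda>x. t \<in> f x)"
  shows "continuous_map X (ray_topology r) f"
  unfolding ray_topology_def
proof (rule continuous_map_into_subtopology)
  let ?F = "product_topology (\<lambda>_. discrete_topology (UNIV :: bool set)) (Field r)"
  let ?c = "\<lambda>x. restrict (\<lambda>t. t \<in> x) (Field r)"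
  have "continuous_map X ?F (?c \<circ> f)"
    unfolding continuous_map_componentwise
  proof (intro conjI ballI)
    show "(?c \<circ> f) ` topspace X \<subseteq> extensional (Field r)" by auto
    fix t assume "t \<in> Field r"
    then show "continuous_map X (discrete_topology UNIV) (\<lambda>x. (?c \<circ> f) x t)"
      using assms(2) by simp
  qed
  moreover have "topspace X \<subseteq> f -` Pow (Field r)"
    using assms(1) rays_subset[of r] by blast
  ultimately show "continuous_map X (powerset_topology (Field r)) f"
    unfolding powerset_topology_def by (rule continuous_map_pullback')
qed (use assms in auto)

lemma continuous_map_ray_member:
  assumes "t \<in> Field r"
  shows "continuous_map (ray_topology r) (discrete_topology UNIV) (\<lambda>x. t \<in> x)"
proof -
  let ?F = "product_topology (\<lambda>_. discrete_topology (UNIV :: bool set)) (Field r)"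
  have "continuous_map ?F (discrete_topology UNIV) (\<lambda>f. f t)"
    by (rule continuous_map_product_projection[OF assms])
  from continuous_map_pullback[OF this, of "Pow (Field r)" "\<lambda>x. restrict (\<lambda>t. t \<in> x) (Field r)"]
  have "continuous_map (powerset_topology (Field r)) (discrete_topology UNIV) (\<lambda>x. t \<in> x)"
    using assms by (simp add: powerset_topology_def o_def)
  then show ?thesis
    unfolding ray_topology_def by (rule continuous_map_from_subtopology)
qed


subsection \<open>Independence of the type carrying the tree\<close>

lemma treeD:
  assumes "is_tree r"
  shows "\<And>t. t \<in> Field r \<Longrightarrow> (t, t) \<in> r"
    and "\<And>a b c. (a, b) \<in> r \<Longrightarrow> (b, c) \<in> r \<Longrightarrow> (a, c) \<in> r"
    and "\<And>a b. (a, b) \<in> r \<Longrightarrow> (b, a) \<in> r \<Longrightarrow> a = b"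
proof -
  have "refl_on (Field r) r" "trans r" "antisym r"
    using assms by (auto simp: is_tree_def partial_order_on_def preorder_on_def)
  then show "\<And>t. t \<in> Field r \<Longrightarrow> (t, t) \<in> r"
    and "\<And>a b c. (a, b) \<in> r \<Longrightarrow> (b, c) \<in> r \<Longrightarrow> (a, c) \<in> r"
    and "\<And>a b. (a, b) \<in> r \<Longrightarrow> (b, a) \<in> r \<Longrightarrow> a = b"
    by (simp_all add: refl_on_def) (meson transD antisymD)+
qed

lemma rayD:
  assumes "x \<in> rays r"
  shows "x \<subseteq> Field r" "\<And>s t. t \<in> x \<Longrightarrow> (s, t) \<in> r \<Longrightarrow> s \<in> x"
    "\<And>s t. s \<in> x \<Longrightarrow> t \<in> x \<Longrightarrow> (s, t) \<in> r \<or> (t, s) \<in> r"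
    "\<And>s. s \<in> x \<Longrightarrow> \<exists>t\<in>x. (s, t) \<in> r \<and> s \<noteq> t"
  using assms by (auto simp: rays_def ofilter_def under_def Chains_def)

lemma ray_least:
  assumes T: "is_tree r" and x: "x \<in> rays r" and A: "A \<subseteq> x" "A \<noteq> {}"
  shows "\<exists>m\<in>A. \<forall>a\<in>A. (m, a) \<in> r"
proof -
  obtain a where a: "a \<in> A" using A by auto
  then have aF: "a \<in> Field r" using A rayD(1)[OF x] by auto
  have wf: "wf (Restr r (under r a) - Id)"
    using T aF by (auto simp: is_tree_def well_order_on_def)
  have "a \<in> A \<inter> under r a" using a treeD(1)[OF T aF] by (auto simp: under_def)
  then obtain m where m: "m \<in> A \<inter> under r a"
    and min: "\<And>y. (y, m) \<in> Restr r (under r a) - Id \<Longrightarrow> y \<notin> A \<inter> under r a"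
    using wfE_min[OF wf] by metis
  have "(m, b) \<in> r" if b: "b \<in> A" for b
  proof (cases "(b, a) \<in> r")
    case True
    then have bu: "b \<in> A \<inter> under r a" using b by (auto simp: under_def)
    have mF: "m \<in> Field r" "m \<in> x" "b \<in> x" using m A b rayD(1)[OF x] by auto
    show ?thesis
      using min[of b] bu m rayD(3)[OF x mF(2,3)] treeD(1)[OF T mF(1)] by auto
  next
    case False
    then have "(a, b) \<in> r" using rayD(3)[OF x, of a b] a b A by auto
    then show ?thesis using m treeD(2)[OF T] by (auto simp: under_def)
  qed
  then show ?thesis using m by auto
qed

text \<open>Every node on a ray lies on a ray that is countable above this node.\<close>

lemma ray_countable_above:
  assumes T: "is_tree r" and x: "x \<in> rays r" and s: "s \<in> x"
  shows "\<exists>y\<in>rays r. s \<in> y \<and> countable {t\<in>y. (s, t) \<in> r}"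
proof -
  have "\<exists>v\<in>x. (u, v) \<in> r \<and> u \<noteq> v \<and> (\<forall>w\<in>x. (u, w) \<in> r \<and> u \<noteq> w \<longrightarrow> (v, w) \<in> r)"
    if u: "u \<in> x" for u
    using ray_least[OF T x, of "{w\<in>x. (u, w) \<in> r \<and> u \<noteq> w}"] rayD(4)[OF x u] by blast
  then obtain f where f: "\<And>u. u \<in> x \<Longrightarrow> f u \<in> x \<and> (u, f u) \<in> r \<and> u \<noteq> f u"
    and fmin: "\<And>u w. u \<in> x \<Longrightarrow> w \<in> x \<Longrightarrow> (u, w) \<in> r \<Longrightarrow> u \<noteq> w \<Longrightarrow> (f u, w) \<in> r"
    by metis
  define c where "c n = (f ^^ n) s" for n
  have c0: "c 0 = s" and cS: "\<And>n. c (Suc n) = f (c n)" by (auto simp: c_def)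
  have cx: "c n \<in> x" for n by (induction n) (auto simp: c0 cS s f)
  define y where "y = {t. \<exists>n. (t, c n) \<in> r}"
  have yx: "y \<subseteq> x" using rayD(2)[OF x] cx by (auto simp: y_def)
  have cy: "c n \<in> y" for n
    using treeD(1)[OF T, of "c n"] cx rayD(1)[OF x] by (auto simp: y_def)
  have "\<exists>t\<in>y. (u, t) \<in> r \<and> u \<noteq> t" if u: "u \<in> y" for u
  proof -
    obtain n where n: "(u, c n) \<in> r" using u by (auto simp: y_def)
    have st: "(c n, c (Suc n)) \<in> r" "c n \<noteq> c (Suc n)" using f[OF cx[of n]] by (auto simp: cS)
    have "(u, c (Suc n)) \<in> r" using treeD(2)[OF T n st(1)] .
    moreover have "u \<noteq> c (Suc n)" using n st treeD(3)[OF T] by auto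
    ultimately show ?thesis using cy by blast
  qed
  moreover have "ofilter r y"
    using yx rayD(1)[OF x] treeD(2)[OF T] unfolding ofilter_def under_def y_def by blast
  moreover have "y \<in> Chains r" using yx rayD(3)[OF x] by (auto simp: Chains_def)
  ultimately have yr: "y \<in> rays r" using cy by (auto simp: rays_def)
  have fin: "t \<in> range c" if "(s, t) \<in> r" "(t, c n) \<in> r" for t n
    using that
  proof (induction n)
    case 0
    then have "t = c 0" using treeD(3)[OF T] c0 by auto
    then show ?case by auto
  next
    case (Suc n)
    have tx: "t \<in> x" using Suc.prems rayD(2)[OF x cx] by auto
    show ?case
    proof (cases "(t, c n) \<in> r")
      case True then show ?thesis using Suc by auto
    next
      case False
      then have "(c n, t) \<in> r" "c n \<noteq> t"
        using rayD(3)[OF x tx cx[of n]] rayD(1)[OF x] tx treeD(1)[OF T, of t] by auto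
      then have "(c (Suc n), t) \<in> r" using fmin[OF cx tx] by (auto simp: cS)
      then have "t = c (Suc n)" using Suc.prems treeD(3)[OF T] by auto
      then show ?thesis by auto
    qed
  qed
  have "{t\<in>y. (s, t) \<in> r} \<subseteq> range c" using fin unfolding y_def by blast
  then have "countable {t\<in>y. (s, t) \<in> r}" by (rule countable_subset) simp
  then show ?thesis using yr cy[of 0] c0 by auto
qed

lemma tree_nodes_inj:
  assumes T: "is_tree r"
  shows "\<exists>g :: 'a \<Rightarrow> 'a set \<times> nat. inj_on g (\<Union>(rays r)) \<and> g ` \<Union>(rays r) \<subseteq> rays r \<times> UNIV"
proof -
  let ?P = "\<Union>(rays r)"
  have "\<forall>s\<in>?P. \<exists>y. y \<in> rays r \<and> s \<in> y \<and> countable {t\<in>y. (s, t) \<in> r}"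
    using ray_countable_above[OF T] by blast
  then obtain q where "\<forall>s\<in>?P. q s \<in> rays r \<and> s \<in> q s \<and> countable {t\<in>q s. (s, t) \<in> r}"
    by (rule bchoice[THEN exE])
  then have q: "q s \<in> rays r" "s \<in> q s" "countable {t\<in>q s. (s, t) \<in> r}" if "s \<in> ?P" for s
    using that by blast+
  define F where "F y = {s\<in>?P. q s = y}" for y
  have cF: "countable (F y)" for y
  proof (cases "F y = {}")
    case False
    then have y: "y \<in> rays r" "F y \<subseteq> y" using q(1,2) unfolding F_def by blast+
    obtain m where m: "m \<in> F y" "\<forall>a\<in>F y. (m, a) \<in> r" using ray_least[OF T y False] by auto
    then have "F y \<subseteq> {t\<in>q m. (m, t) \<in> r}" using y by (auto simp: F_def)
    moreover have "countable {t\<in>q m. (m, t) \<in> r}" using q(3)[of m] m by (simp add: F_def)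
    ultimately show ?thesis by (rule countable_subset)
  qed auto
  define g where "g s = (q s, to_nat_on (F (q s)) s)" for s
  have "inj_on g ?P"
  proof (rule inj_onI)
    fix s t assume st: "s \<in> ?P" "t \<in> ?P" "g s = g t"
    then have "q s = q t" "s \<in> F (q s)" "t \<in> F (q s)" by (auto simp: g_def F_def)
    then show "s = t" using st(3) inj_on_to_nat_on[OF cF, of "q s"] by (auto simp: g_def inj_on_def)
  qed
  moreover have "g ` ?P \<subseteq> rays r \<times> UNIV" using q(1) unfolding g_def by blast
  ultimately show ?thesis by blast
qed

text \<open>Transport along an injection defined on the nodes that lie on some ray.\<close>

lemma ray_topology_transport:
  fixes r :: "'a rel" and g :: "'a \<Rightarrow> 'b"
  assumes T: "is_tree r" and ne: "rays r \<noteq> {}" and inj: "inj_on g (\<Union>(rays r))"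
  shows "\<exists>S :: 'b rel. is_tree S \<and> ray_topology r homeomorphic_space ray_topology S"
proof -
  let ?P = "\<Union>(rays r)"
  define S where "S = {(g a, g b) |a b. (a, b) \<in> r \<and> a \<in> ?P \<and> b \<in> ?P}"
  define k where "k y = {a\<in>?P. g a \<in> y}" for y
  note tr = treeD[OF T]
  have PF: "?P \<subseteq> Field r" using rays_subset by auto
  have Pd: "s \<in> ?P" if "t \<in> ?P" "(s, t) \<in> r" for s t
  proof -
    obtain x where x: "x \<in> rays r" "t \<in> x" using \<open>t \<in> ?P\<close> by blast
    show ?thesis using rayD(2)[OF x that(2)] x(1) by blast
  qed
  have Sg: "(g a, g b) \<in> S \<longleftrightarrow> (a, b) \<in> r" if "a \<in> ?P" "b \<in> ?P" for a b
  proof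
    assume "(g a, g b) \<in> S"
    then obtain a' b' where "g a = g a'" "g b = g b'" "(a', b') \<in> r" "a' \<in> ?P" "b' \<in> ?P"
      unfolding S_def by blast
    then show "(a, b) \<in> r" using inj_onD[OF inj, of a a'] inj_onD[OF inj, of b b'] that by simp
  qed (use that S_def in blast)
  have FS: "Field S = g ` ?P"
  proof
    show "g ` ?P \<subseteq> Field S"
    proof
      fix u assume "u \<in> g ` ?P"
      then obtain a where a: "a \<in> ?P" "u = g a" by auto
      then have "(u, u) \<in> S" using Sg[of a a] tr(1)[of a] PF by auto
      then show "u \<in> Field S" by (auto simp: Field_def)
    qed
  qed (auto simp: S_def Field_def)
  have underS: "under S (g t) = g ` under r t" if t: "t \<in> ?P" for t
  proof
    show "under S (g t) \<subseteq> g ` under r t"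
    proof
      fix u assume "u \<in> under S (g t)"
      then have u: "(u, g t) \<in> S" by (auto simp: under_def)
      then obtain a where a: "a \<in> ?P" "u = g a" unfolding S_def by blast
      then show "u \<in> g ` under r t" using u Sg[OF a(1) t] by (auto simp: under_def)
    qed
    show "g ` under r t \<subseteq> under S (g t)"
    proof
      fix u assume "u \<in> g ` under r t"
      then obtain a where a: "(a, t) \<in> r" "u = g a" by (auto simp: under_def)
      then show "u \<in> under S (g t)" using Sg[OF Pd[OF t a(1)] t] by (auto simp: under_def)
    qed
  qed
  have tS: "is_tree S"
    unfolding is_tree_def
  proof (intro conjI ballI)
    have SE: "\<exists>a\<in>?P. \<exists>b\<in>?P. u = g a \<and> v = g b \<and> (a, b) \<in> r" if "(u, v) \<in> S" for u v
      using that unfolding S_def by blast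
    have S3: "(u, w) \<in> S" if h: "(u, v) \<in> S" "(v, w) \<in> S" for u v w
    proof -
      obtain a b where ab: "a \<in> ?P" "b \<in> ?P" "u = g a" "v = g b" "(a, b) \<in> r"
        using SE[OF h(1)] by blast
      obtain b' c where bc: "b' \<in> ?P" "c \<in> ?P" "v = g b'" "w = g c" "(b', c) \<in> r"
        using SE[OF h(2)] by blast
      have "b = b'" using inj_onD[OF inj _ ab(2) bc(1)] ab bc by simp
      then have "(a, c) \<in> r" using tr(2) ab(5) bc(5) by blast
      then show ?thesis using Sg[OF ab(1) bc(2)] ab bc by simp
    qed
    have S4: "u = v" if h: "(u, v) \<in> S" "(v, u) \<in> S" for u v
    proof -
      obtain a b where ab: "a \<in> ?P" "b \<in> ?P" "u = g a" "v = g b" "(a, b) \<in> r"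
        using SE[OF h(1)] by blast
      then have "(b, a) \<in> r" using Sg[OF ab(2,1)] h(2) by simp
      then show ?thesis using tr(3)[OF ab(5)] ab by simp
    qed
    have S1: "\<And>a. a \<in> Field S \<Longrightarrow> (a, a) \<in> S"
    proof -
      fix u assume "u \<in> Field S"
      then obtain a where a: "a \<in> ?P" "u = g a" unfolding FS by blast
      then have "(a, a) \<in> r" using tr(1) PF by blast
      then show "(u, u) \<in> S" using Sg[OF a(1) a(1)] a(2) by simp
    qed
    show po: "partial_order_on (Field S) S"
      unfolding partial_order_on_def preorder_on_def
    proof (intro conjI)
      show "S \<subseteq> Field S \<times> Field S" by (auto simp: Field_def)
      show "refl_on (Field S) S" using S1 by (simp add: refl_on_def)
      show "trans S" using S3 by (rule transI)
      show "antisym S" using S4 by (rule antisymI)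
    qed
    obtain x where x: "x \<in> rays r" using ne by auto
    then obtain a where a: "a \<in> x" by (auto simp: rays_def)
    obtain m where m: "m \<in> Field r" "\<forall>t\<in>Field r. (m, t) \<in> r" using T by (auto simp: is_tree_def)
    have mP: "m \<in> ?P" using Pd[of a m] a x m PF by auto
    show "\<exists>m\<in>Field S. \<forall>t\<in>Field S. (m, t) \<in> S"
    proof (intro bexI ballI)
      show "g m \<in> Field S" using mP unfolding FS by (rule imageI)
      fix u assume "u \<in> Field S"
      then obtain t where t: "t \<in> ?P" "u = g t" unfolding FS by blast
      then have "(m, t) \<in> r" using m(2) PF by blast
      then show "(g m, u) \<in> S" using Sg[OF mP t(1)] t(2) by simp
    qed
    fix u assume "u \<in> Field S"
    then obtain t where t: "t \<in> ?P" "u = g t" unfolding FS by blast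
    then obtain x where xt: "x \<in> rays r" "t \<in> x" by auto
    let ?U = "under S u"
    have uim: "?U = g ` under r t" using underS t by auto
    have xP: "x \<subseteq> ?P" using xt(1) by blast
    have ux: "under r t \<subseteq> x" using rayD(2)[OF xt] by (simp add: under_def subset_iff)
    have tot: "(a, b) \<in> S \<or> (b, a) \<in> S" if ab: "a \<in> ?U" "b \<in> ?U" for a b
    proof -
      obtain a' b' where a': "a = g a'" "b = g b'" "a' \<in> x" "b' \<in> x" using ab uim ux by blast
      then have "a' \<in> ?P" "b' \<in> ?P" using xP by blast+
      then show ?thesis using rayD(3)[OF xt(1) a'(3,4)] Sg[of a' b'] Sg[of b' a'] a' by simp
    qed
    have wf: "wf (Restr S ?U - Id)"
    proof (rule wfI_min)
      fix u0 :: 'b and Q assume Q: "u0 \<in> Q"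
      show "\<exists>z\<in>Q. \<forall>y. (y, z) \<in> Restr S ?U - Id \<longrightarrow> y \<notin> Q"
      proof (cases "Q \<inter> ?U = {}")
        case True then show ?thesis using Q by auto
      next
        case False
        let ?A = "{a\<in>under r t. g a \<in> Q}"
        have A: "?A \<subseteq> x" "?A \<noteq> {}" using False ux unfolding uim by blast+
        obtain m where m: "m \<in> ?A" "\<forall>a\<in>?A. (m, a) \<in> r"
          using ray_least[OF T xt(1) A] by (rule bexE)
        have "y \<notin> Q" if y: "(y, g m) \<in> Restr S ?U - Id" for y
        proof
          assume "y \<in> Q"
          moreover have "y \<in> g ` under r t" using y uim by simp
          ultimately obtain b where b: "b \<in> ?A" "y = g b" by blast
          have "m \<in> ?P" "b \<in> ?P" using m(1) b(1) A(1) xP by blast+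
          then have "(g m, y) \<in> S" using m(2) Sg[of m b] b by blast
          then show False using S4[of y "g m"] y by blast
        qed
        then show ?thesis using m(1) by (intro bexI[of _ "g m"]) simp_all
      qed
    qed
    have "?U \<subseteq> Field S" by (auto simp: under_def Field_def)
    then have "refl_on ?U (Restr S ?U)" using S1 by (auto simp: refl_on_def)
    moreover have "trans (Restr S ?U)" by (intro transI) (use S3 in blast)
    moreover have "antisym (Restr S ?U)" by (intro antisymI) (use S4 in blast)
    moreover have "total_on ?U (Restr S ?U)" using tot by (auto simp: total_on_def)
    ultimately show "well_order_on ?U (Restr S ?U)"
      using wf unfolding order_on_defs by simp
  qed
  have gx: "g ` x \<in> rays S" if x: "x \<in> rays r" for x
  proof -
    have xP: "x \<subseteq> ?P" using x by auto
    have "ofilter S (g ` x)"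
      unfolding ofilter_def
    proof (intro conjI ballI)
      show "g ` x \<subseteq> Field S" using xP unfolding FS by (rule image_mono)
      fix u assume "u \<in> g ` x"
      then obtain t where t: "t \<in> x" "u = g t" by blast
      have "under r t \<subseteq> x" using rayD(2)[OF x t(1)] by (simp add: under_def subset_iff)
      moreover have "under S u = g ` under r t" using underS[of t] t xP by blast
      ultimately show "under S u \<subseteq> g ` x" by blast
    qed
    moreover have "g ` x \<in> Chains S"
    proof -
      have "(g a, g b) \<in> S \<or> (g b, g a) \<in> S" if ab: "a \<in> x" "b \<in> x" for a b
        using rayD(3)[OF x ab] Sg[of a b] Sg[of b a] ab xP by blast
      then show ?thesis by (simp add: Chains_def)
    qed
    moreover have "\<exists>t\<in>g ` x. (s, t) \<in> S \<and> s \<noteq> t" if s: "s \<in> g ` x" for s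
    proof -
      obtain a where a: "a \<in> x" "s = g a" using s by blast
      obtain b where b: "b \<in> x" "(a, b) \<in> r" "a \<noteq> b" using rayD(4)[OF x a(1)] by blast
      have "(g a, g b) \<in> S" "g a \<noteq> g b"
        using Sg[of a b] inj_onD[OF inj, of a b] a b xP by blast+
      then show ?thesis using a b by blast
    qed
    moreover have "x \<noteq> {}" using x by (simp add: rays_def)
    ultimately show ?thesis by (simp add: rays_def)
  qed
  have ky: "k y \<in> rays r" if y: "y \<in> rays S" for y
  proof -
    have yF: "y \<subseteq> g ` ?P" using rayD(1)[OF y] unfolding FS .
    have yne: "y \<noteq> {}" using y by (auto simp: rays_def)
    have gk: "g ` k y = y" using yF by (fastforce simp: k_def image_iff simp del: Union_iff)
    have "k y \<noteq> {}" using gk yne by (metis image_empty)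
    moreover have "ofilter r (k y)"
      unfolding ofilter_def
    proof (intro conjI ballI subsetI)
      fix t assume "t \<in> k y" then have "t \<in> ?P" by (simp add: k_def del: Union_iff)
      then show "t \<in> Field r" using PF by (rule subsetD[rotated])
    next
      fix t s assume t: "t \<in> k y" and s: "s \<in> under r t"
      then have tP: "t \<in> ?P" "g t \<in> y" and st: "(s, t) \<in> r" by (simp_all add: k_def under_def del: Union_iff)
      have sP: "s \<in> ?P" using Pd[OF tP(1) st] .
      have "(g s, g t) \<in> S" using Sg[OF sP tP(1)] st by simp
      then show "s \<in> k y" using rayD(2)[OF y tP(2)] \<open>(g s, g t) \<in> S\<close> sP
        by (simp add: k_def del: Union_iff)
    qed
    moreover have "k y \<in> Chains r"
    proof -
      have "(a, b) \<in> r \<or> (b, a) \<in> r" if ab: "a \<in> k y" "b \<in> k y" for a b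
      proof -
        have ab': "a \<in> ?P" "b \<in> ?P" "g a \<in> y" "g b \<in> y" using ab by (simp_all add: k_def del: Union_iff)
        show ?thesis using rayD(3)[OF y ab'(3,4)] Sg[OF ab'(1,2)] Sg[OF ab'(2,1)] by simp
      qed
      then show ?thesis by (simp add: Chains_def)
    qed
    moreover have "\<exists>t\<in>k y. (s, t) \<in> r \<and> s \<noteq> t" if s: "s \<in> k y" for s
    proof -
      have sP: "s \<in> ?P" "g s \<in> y" using s by (simp_all add: k_def del: Union_iff)
      obtain u where u: "u \<in> y" "(g s, u) \<in> S" "g s \<noteq> u" using rayD(4)[OF y sP(2)] by blast
      have "u \<in> g ` k y" using u(1) by (simp only: gk)
      then obtain t where t: "u = g t" "t \<in> k y" by (rule imageE)
      then have "t \<in> ?P" by (simp add: k_def del: Union_iff)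
      then have "(s, t) \<in> r" "s \<noteq> t" using u t Sg[OF sP(1)] by auto
      then show ?thesis using t(2) by blast
    qed
    ultimately show ?thesis by (simp add: rays_def)
  qed
  have "homeomorphic_maps (ray_topology r) (ray_topology S) (image g) k"
    unfolding homeomorphic_maps_def
  proof (intro conjI ballI)
    show "continuous_map (ray_topology r) (ray_topology S) (image g)"
    proof (rule continuous_map_into_ray_topology)
      fix u assume "u \<in> Field S"
      then obtain t where t: "t \<in> ?P" "u = g t" unfolding FS by blast
      have "t \<in> x \<longleftrightarrow> u \<in> g ` x" if x: "x \<in> topspace (ray_topology r)" for x
      proof -
        have "x \<subseteq> ?P" using x by auto
        then show ?thesis using inj_on_image_mem_iff[OF inj t(1)] t(2) by simp
      qed
      moreover have "continuous_map (ray_topology r) (discrete_topology UNIV) (\<lambda>x. t \<in> x)"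
        by (rule continuous_map_ray_member) (use t PF in blast)
      ultimately show "continuous_map (ray_topology r) (discrete_topology UNIV) (\<lambda>x. u \<in> g ` x)"
        by (rule continuous_map_eq[rotated])
    qed (use gx in auto)
    show "continuous_map (ray_topology S) (ray_topology r) k"
    proof (rule continuous_map_into_ray_topology)
      fix t assume "t \<in> Field r"
      show "continuous_map (ray_topology S) (discrete_topology UNIV) (\<lambda>y. t \<in> k y)"
      proof (cases "t \<in> ?P")
        case True
        then have "continuous_map (ray_topology S) (discrete_topology UNIV) (\<lambda>y. g t \<in> y)"
          by (intro continuous_map_ray_member) (simp only: FS imageI[OF True])
        then show ?thesis using True by (simp add: k_def)
      next
        case False
        then have "(\<lambda>y. t \<in> k y) = (\<lambda>_. False)" unfolding k_def by blast
        then show ?thesis by simp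
      qed
    qed (use ky in auto)
  next
    fix x assume "x \<in> topspace (ray_topology r)"
    then have xP: "x \<subseteq> ?P" by auto
    then show "k (g ` x) = x" using inj_on_image_mem_iff[OF inj _ xP] unfolding k_def by blast
  next
    fix y assume "y \<in> topspace (ray_topology S)"
    then have "y \<subseteq> g ` ?P" using rayD(1)[of y S] unfolding FS by simp
    then show "g ` k y = y" by (fastforce simp: k_def image_iff simp del: Union_iff)
  qed
  then show ?thesis using tS unfolding homeomorphic_space_def by blast
qed

theorem ray_spaceI:
  fixes r :: "'a rel" and X :: "'x topology"
  assumes T: "is_tree r" and X: "X homeomorphic_space ray_topology r"
  shows "ray_space X"
proof (cases "rays r = {}")
  case True
  define p :: "'x \<times> nat" where "p = undefined"
  have "is_tree {(p, p)}"
    by (auto simp: is_tree_def order_on_defs refl_on_def trans_def antisym_def total_on_def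
        under_def Field_def)
  moreover have rp: "rays {(p, p)} = {}" by (auto simp: rays_def)
  moreover have "X homeomorphic_space ray_topology {(p, p)}"
  proof -
    have "ray_topology r = trivial_topology"
      using True by (metis null_topspace_iff_trivial topspace_ray_topology)
    then have "X = trivial_topology" using homeomorphic_empty_space[OF X] by simp
    moreover have "ray_topology {(p, p)} = trivial_topology"
      using rp by (metis null_topspace_iff_trivial topspace_ray_topology)
    ultimately show ?thesis using homeomorphic_empty_space_eq by metis
  qed
  ultimately show ?thesis unfolding ray_space_def by blast
next
  case False
  obtain g :: "'a \<Rightarrow> 'a set \<times> nat"
    where g: "inj_on g (\<Union>(rays r))" "g ` \<Union>(rays r) \<subseteq> rays r \<times> UNIV"
    using tree_nodes_inj[OF T] by (elim exE conjE)
  obtain f h where fh: "homeomorphic_maps X (ray_topology r) f h"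
    using X by (auto simp: homeomorphic_space_def)
  then have h: "inj_on h (rays r)"
    by (intro inj_on_inverseI[of _ f]) (auto simp: homeomorphic_maps_def)
  have "inj_on (map_prod h id) (g ` \<Union>(rays r))"
    using inj_on_subset[OF map_prod_inj_on[OF h inj_on_id] g(2)] .
  then have "inj_on (map_prod h id \<circ> g) (\<Union>(rays r))" using g(1) by (intro comp_inj_on)
  then obtain S :: "('x \<times> nat) rel"
    where "is_tree S" "ray_topology r homeomorphic_space ray_topology S"
    using ray_topology_transport[OF T False] by blast
  then show ?thesis unfolding ray_space_def using homeomorphic_space_trans[OF X] by blast
qed

end

theory Submission
  imports Defs
begin

text \<open>
  If \<open>\<R>(T')\<close> is discrete, the product is a disjoint union of copies of \<open>\<R>(T)\<close>, and hence the ray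
  space of the disjoint union of copies of \<open>T\<close> put above a new root.

  Conversely, \<open>\<R>(T)\<close> contains a ray \<open>x\<close> of uncountable cofinality, and a ray space that is not
  discrete contains a nontrivial convergent sequence \<open>z n \<longlonglongrightarrow> y\<close>. So the product contains a version
  of the Tychonoff plank with corner \<open>(x, y)\<close>. A continuous injection \<open>h\<close> of it into a ray space
  maps \<open>(x, y)\<close> to a ray \<open>p\<close> of uncountable cofinality, because rays of countable cofinality are not
  limits of \<open>\<omega>\<^sub>1\<close>-sequences that are continuous at countable limits. On the other hand, the rays
  \<open>h (x, z n)\<close> can only converge to such a \<open>p\<close> by branching off above \<open>p\<close>, through distinct nodes
  for infinitely many \<open>n\<close>, and this contradicts continuity along the other edge of the plank.
\<close>

section \<open>Neighbourhoods and convergence in ray spaces\<close>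

text \<open>A basic box of the product topology constrains only finitely many coordinates; these
  form \<open>F\<close>.\<close>

lemma ray_topology_basis:
  assumes U: "openin (ray_topology r) U" and y: "y \<in> U"
  shows "\<exists>F. finite F \<and> F \<subseteq> Field r \<and> (\<forall>z\<in>rays r. (\<forall>t\<in>F. t \<in> z \<longleftrightarrow> t \<in> y) \<longrightarrow> z \<in> U)"
proof -
  let ?c = "\<lambda>x. restrict (\<lambda>t. t \<in> x) (Field r)"
  have yr: "y \<in> rays r" using openin_subset[OF U] y by auto
  obtain V where V: "openin (product_topology (\<lambda>_. discrete_topology (UNIV :: bool set)) (Field r)) V"
    "U = (?c -` V \<inter> Pow (Field r)) \<inter> rays r"
    using U unfolding ray_topology_def powerset_topology_def openin_subtopology
      openin_pullback_topology by auto
  have "?c y \<in> V" using y V(2) by auto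
  then obtain W where W: "finite {i \<in> Field r. W i \<noteq> UNIV}" "?c y \<in> Pi\<^sub>E (Field r) W"
    "Pi\<^sub>E (Field r) W \<subseteq> V"
    using V(1) unfolding openin_product_topology_alt topspace_discrete_topology by meson
  let ?F = "{i \<in> Field r. W i \<noteq> UNIV}"
  have "z \<in> U" if z: "z \<in> rays r" "\<forall>t\<in>?F. t \<in> z \<longleftrightarrow> t \<in> y" for z
  proof -
    have "(t \<in> z) \<in> W t" if t: "t \<in> Field r" for t
    proof (cases "W t = UNIV")
      case False
      then have "(t \<in> z) = (t \<in> y)" using t z(2) by auto
      moreover have "(t \<in> y) \<in> W t" using PiE_mem[OF W(2) t] t by simp
      ultimately show ?thesis by simp
    qed simp
    then have "?c z \<in> Pi\<^sub>E (Field r) W" by simp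
    then show ?thesis using W(3) V(2) z(1) rays_subset[of r] by blast
  qed
  then show ?thesis using W(1) by (intro exI[of _ ?F]) auto
qed

lemma openin_ray_cylinder:
  assumes "finite F" "F \<subseteq> Field r"
  shows "openin (ray_topology r) {z \<in> rays r. \<forall>t\<in>F. t \<in> z \<longleftrightarrow> t \<in> y}"
proof -
  have "openin (ray_topology r) {z \<in> topspace (ray_topology r). (t \<in> z) \<in> {t \<in> y}}"
    if "t \<in> F" for t
    using that assms(2) by (intro openin_continuous_map_preimage[OF continuous_map_ray_member]) auto
  then have one: "openin (ray_topology r) {z \<in> rays r. t \<in> z \<longleftrightarrow> t \<in> y}" if "t \<in> F" for t
    using that by simp
  have "{z \<in> rays r. \<forall>t\<in>F. t \<in> z \<longleftrightarrow> t \<in> y} =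
      topspace (ray_topology r) \<inter> (\<Inter>t\<in>F. {z \<in> rays r. t \<in> z \<longleftrightarrow> t \<in> y})"
    by auto
  moreover have "openin (ray_topology r)
      (topspace (ray_topology r) \<inter> (\<Inter>t\<in>F. {z \<in> rays r. t \<in> z \<longleftrightarrow> t \<in> y}))"
  proof (cases "F = {}")
    case False
    then show ?thesis using one assms(1) openin_topspace[of "ray_topology r"] by (intro openin_Int openin_INT2) auto
  qed (use openin_topspace[of "ray_topology r"] in simp)
  ultimately show ?thesis by simp
qed

lemma limitin_ray_topologyI:
  assumes y: "y \<in> rays r" and z: "\<And>n. z n \<in> rays r"
    and ev: "\<And>t. t \<in> Field r \<Longrightarrow> \<forall>\<^sub>F n in sequentially. t \<in> z n \<longleftrightarrow> t \<in> y"
  shows "limitin (ray_topology r) z y sequentially"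
  unfolding limitin_def
proof (intro conjI allI impI)
  show "y \<in> topspace (ray_topology r)" using y by simp
  fix U assume "openin (ray_topology r) U \<and> y \<in> U"
  then obtain F where F: "finite F" "F \<subseteq> Field r"
    "\<And>z. z \<in> rays r \<Longrightarrow> \<forall>t\<in>F. t \<in> z \<longleftrightarrow> t \<in> y \<Longrightarrow> z \<in> U"
    using ray_topology_basis by meson
  have "\<forall>\<^sub>F n in sequentially. \<forall>t\<in>F. t \<in> z n \<longleftrightarrow> t \<in> y"
    using F(1,2) ev by (intro eventually_ball_finite) auto
  then show "\<forall>\<^sub>F n in sequentially. z n \<in> U"
    by (rule eventually_mono) (use F(3) z in blast)
qed

text \<open>Coordinatewise form of the convergence of images under \<open>g\<close>. For
  \<open>t\<close> outside \<open>Field r\<close> both sides are eventually false, so later uses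
  carry no side condition on \<open>t\<close>.\<close>

lemma limitin_ray_member:
  assumes "limitin X z y F" "continuous_map X (ray_topology r) g"
  shows "\<forall>\<^sub>F n in F. t \<in> g (z n) \<longleftrightarrow> t \<in> g y"
proof (cases "t \<in> Field r")
  case True
  have lim: "limitin (ray_topology r) (g \<circ> z) (g y) F"
    using continuous_map_limit[OF assms(2,1)] .
  have "limitin (discrete_topology UNIV) ((\<lambda>x. t \<in> x) \<circ> (g \<circ> z)) (t \<in> g y) F"
    using continuous_map_limit[OF continuous_map_ray_member[OF True] lim] by simp
  from limitinD[OF this, of "{t \<in> g y}"] show ?thesis by simp
next
  case False
  have gX: "g u \<in> rays r" if "u \<in> topspace X" for u
    using continuous_map_funspace[OF assms(2)] that by auto
  have y: "y \<in> topspace X" using assms(1) by (simp add: limitin_def)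
  have "\<forall>\<^sub>F n in F. z n \<in> topspace X" using assms(1) y by (auto simp: limitin_def)
  then show ?thesis
    by (rule eventually_mono) (use gX y False rayD(1) in blast)
qed

section \<open>Rays of uncountable cofinality and their initial segments\<close>

text \<open>Weak bounds suffice, since a ray has no maximum and a bound can always be pushed
  strictly upwards. Countable subsets appear as sequences so that countably many choices can be
  bounded directly.\<close>

definition uncountable_cofinality :: "'a rel \<Rightarrow> 'a set \<Rightarrow> bool" where
  "uncountable_cofinality r x \<longleftrightarrow>
     (\<forall>c :: nat \<Rightarrow> 'a. range c \<subseteq> x \<longrightarrow> (\<exists>t\<in>x. \<forall>n. (c n, t) \<in> r))"

lemma uncountable_cofinalityD:
  assumes "uncountable_cofinality r x" "\<And>n. c n \<in> x"
  obtains t where "t \<in> x" "\<And>n :: nat. (c n, t) \<in> r"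
  using assms unfolding uncountable_cofinality_def by blast

lemma uncountable_cofinality_two:
  assumes x: "uncountable_cofinality r x" and ab: "a \<in> x" "b \<in> x"
  obtains t where "t \<in> x" "(a, t) \<in> r" "(b, t) \<in> r"
proof -
  have "(if n = 0 then a else b) \<in> x" for n :: nat using ab by simp
  from uncountable_cofinalityD[OF x, of "\<lambda>n. if n = 0 then a else b", OF this]
  obtain t where t: "t \<in> x" "\<And>n :: nat. ((if n = 0 then a else b), t) \<in> r" by blast
  from t(2)[of 0] t(2)[of 1] show ?thesis using that t(1) by simp
qed

lemma Union_rays:
  assumes x: "x \<in> rays r" and A: "A \<noteq> {}" "A \<subseteq> rays r" "\<Union>A \<subseteq> x"
  shows "\<Union>A \<in> rays r"
proof -
  obtain a where "a \<in> A" "a \<in> rays r" using A(1,2) by blast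
  moreover have "a \<noteq> {}" using \<open>a \<in> rays r\<close> by (simp add: rays_def)
  ultimately have "\<Union>A \<noteq> {}" by blast
  moreover have "ofilter r (\<Union>A)"
    unfolding ofilter_def
  proof (intro conjI ballI)
    show "\<Union>A \<subseteq> Field r" using A(3) rayD(1)[OF x] by simp
    fix t assume "t \<in> \<Union>A"
    then obtain b where b: "b \<in> A" "t \<in> b" by blast
    then have "b \<in> rays r" using A(2) by blast
    then have "under r t \<subseteq> b" using rayD(2) b(2) by (fastforce simp: under_def)
    then show "under r t \<subseteq> \<Union>A" using b(1) by blast
  qed
  moreover have "\<Union>A \<in> Chains r"
    using A(3) rayD(3)[OF x] unfolding Chains_def by blast
  moreover have "\<exists>t\<in>\<Union>A. (s, t) \<in> r \<and> s \<noteq> t" if "s \<in> \<Union>A" for s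
    using that A(2) rayD(4)[of _ r s] by blast
  ultimately show ?thesis unfolding rays_def by blast
qed

text \<open>The downward closure of a strictly increasing sequence starting at \<open>t\<close> is a
  ray with a countable cofinal subset, so it cannot exhaust \<open>x\<close>.\<close>

lemma initial_ray:
  assumes T: "is_tree r" and x: "x \<in> rays r" "uncountable_cofinality r x" and t: "t \<in> x"
  obtains a where "a \<in> rays r" "a \<subset> x" "t \<in> a"
proof -
  obtain f where f: "\<And>u. u \<in> x \<Longrightarrow> f u \<in> x \<and> (u, f u) \<in> r \<and> u \<noteq> f u"
    using rayD(4)[OF x(1)] by metis
  define c where "c n = (f ^^ n) t" for n
  have c0: "c 0 = t" and cS: "\<And>n. c (Suc n) = f (c n)" by (auto simp: c_def)
  have cx: "c n \<in> x" for n by (induction n) (auto simp: c0 cS t f)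
  define a where "a = {s. \<exists>n. (s, c n) \<in> r}"
  have ax: "a \<subseteq> x" using rayD(2)[OF x(1)] cx by (auto simp: a_def)
  have ca: "c n \<in> a" for n
    using treeD(1)[OF T, of "c n"] cx rayD(1)[OF x(1)] by (auto simp: a_def)
  have "\<exists>t\<in>a. (u, t) \<in> r \<and> u \<noteq> t" if u: "u \<in> a" for u
  proof -
    obtain n where n: "(u, c n) \<in> r" using u by (auto simp: a_def)
    have st: "(c n, c (Suc n)) \<in> r" "c n \<noteq> c (Suc n)" using f[OF cx[of n]] by (auto simp: cS)
    have "(u, c (Suc n)) \<in> r" using treeD(2)[OF T n st(1)] .
    moreover have "u \<noteq> c (Suc n)" using n st treeD(3)[OF T] by auto
    ultimately show ?thesis using ca by blast
  qed
  moreover have "ofilter r a"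
    using ax rayD(1)[OF x(1)] treeD(2)[OF T] unfolding ofilter_def under_def a_def by blast
  moreover have "a \<in> Chains r" using ax rayD(3)[OF x(1)] by (auto simp: Chains_def)
  ultimately have ar: "a \<in> rays r" using ca by (auto simp: rays_def)
  obtain b where b: "b \<in> x" "\<And>n. (c n, b) \<in> r" using uncountable_cofinalityD[where c = c, OF x(2) cx] by metis
  obtain b' where b': "b' \<in> x" "(b, b') \<in> r" "b \<noteq> b'" using rayD(4)[OF x(1) b(1)] by blast
  have "b' \<notin> a"
  proof
    assume "b' \<in> a"
    then obtain n where "(b', c n) \<in> r" by (auto simp: a_def)
    then have "(b', b) \<in> r" using treeD(2)[OF T _ b(2)] by blast
    then show False using treeD(3)[OF T b'(2)] b'(3) by blast
  qed
  then have "a \<subset> x" using ax b'(1) by blast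
  then show ?thesis using that[OF ar] ca[of 0] c0 by auto
qed

text \<open>Successor step for increasing sequences of initial rays: a node \<open>e\<close> outside
  \<open>a\<close> makes the extension strict, and the prescribed \<open>t\<close> lets it be taken
  as long as an argument needs.\<close>

lemma extend_initial_ray:
  assumes T: "is_tree r" and x: "x \<in> rays r" "uncountable_cofinality r x"
    and a: "a \<in> rays r" "a \<subset> x" and t: "t \<in> x"
  obtains b where "b \<in> rays r" "a \<subset> b" "b \<subset> x" "t \<in> b"
proof -
  obtain e where e: "e \<in> x" "e \<notin> a" using a by blast
  obtain u where u: "u \<in> x" "(e, u) \<in> r" "(t, u) \<in> r"
    using uncountable_cofinality_two[OF x(2) e(1) t] by blast
  obtain b where b: "b \<in> rays r" "b \<subset> x" "u \<in> b" using initial_ray[OF T x u(1)] by blast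
  have eb: "e \<in> b" "t \<in> b" using rayD(2)[OF b(1,3)] u by blast+
  have "s \<in> b" if s: "s \<in> a" for s
  proof -
    have "s \<in> x" using s a by blast
    then have "(s, e) \<in> r" using rayD(3)[OF x(1) _ e(1)] rayD(2)[OF a(1) s] e(2) by blast
    then show ?thesis using rayD(2)[OF b(1) eb(1)] by blast
  qed
  then show ?thesis using that[OF b(1) _ b(2)] eb e(2) by blast
qed

text \<open>These are the limits at which continuity is exploited: nodes enter an increasing
  sequence once and stay, and uncountable cofinality keeps the union a proper part of
  \<open>x\<close>.\<close>

lemma UN_initial_rays:
  assumes x: "x \<in> rays r" "uncountable_cofinality r x"
    and a: "\<And>n :: nat. a n \<in> rays r" "\<And>n. a n \<subset> x" "\<And>n. a n \<subset> a (Suc n)"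
  shows "(\<Union>n. a n) \<in> rays r" "(\<Union>n. a n) \<subset> x"
    "limitin (ray_topology r) a (\<Union>n. a n) sequentially"
proof -
  show U: "(\<Union>n. a n) \<in> rays r" by (rule Union_rays[OF x(1)]) (use a in auto)
  have "\<forall>n. \<exists>e. e \<in> x \<and> e \<notin> a n" using a(2) by blast
  then obtain e where e: "\<And>n. e n \<in> x" "\<And>n. e n \<notin> a n" by metis
  obtain u where u: "u \<in> x" "\<And>n. (e n, u) \<in> r" using uncountable_cofinalityD[where c = e, OF x(2) e(1)] by metis
  have "u \<notin> a n" for n using rayD(2)[OF a(1), of u n "e n"] u(2) e(2) by blast
  then show "(\<Union>n. a n) \<subset> x" using u(1) a(2) by blast
  have mono: "incseq a" using a(3) by (intro incseq_SucI) auto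
  show "limitin (ray_topology r) a (\<Union>n. a n) sequentially"
  proof (rule limitin_ray_topologyI[OF U a(1)])
    fix t assume "t \<in> Field r"
    show "\<forall>\<^sub>F n in sequentially. t \<in> a n \<longleftrightarrow> t \<in> (\<Union>n. a n)"
    proof (cases "t \<in> (\<Union>n. a n)")
      case True
      then obtain k where "t \<in> a k" by blast
      then have "\<forall>n\<ge>k. t \<in> a n" using mono by (meson incseq_def subsetD)
      then show ?thesis using True unfolding eventually_sequentially by blast
    qed simp
  qed
qed

section \<open>Continuous images of rays of uncountable cofinality\<close>

lemma ray_finite_bound:
  assumes T: "is_tree r" and x: "x \<in> rays r" and F: "finite F" "F \<subseteq> x"
  shows "\<exists>t\<in>x. \<forall>s\<in>F. (s, t) \<in> r"
  using F
proof (induction F)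
  case empty
  then show ?case using x by (auto simp: rays_def)
next
  case (insert s F)
  then obtain t where t: "t \<in> x" "\<forall>s\<in>F. (s, t) \<in> r" by blast
  have "s \<in> x" using insert.prems by blast
  then have refl: "(s, s) \<in> r" using treeD(1)[OF T] rayD(1)[OF x] by blast
  consider "(s, t) \<in> r" | "(t, s) \<in> r" using rayD(3)[OF x \<open>s \<in> x\<close> t(1)] by blast
  then show ?case
  proof cases
    case 1 then show ?thesis using t by blast
  next
    case 2 then show ?thesis using t(2) refl \<open>s \<in> x\<close> treeD(2)[OF T] by blast
  qed
qed

text \<open>Near \<open>x\<close>, finitely many nodes decide whether \<open>u\<close> lies in
  \<open>g a\<close>. An initial segment \<open>a\<close> of \<open>x\<close> agrees with
  \<open>x\<close> on those outside \<open>x\<close> and, once it contains a node \<open>t\<close>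
  above the others, on those inside. So \<open>t\<close> is a modulus of continuity for the
  coordinate \<open>u\<close>.\<close>

lemma continuous_map_initial_rays:
  assumes T: "is_tree r" and x: "x \<in> rays r" and g: "continuous_map (ray_topology r) (ray_topology s) g"
  shows "\<exists>t\<in>x. \<forall>a\<in>rays r. a \<subseteq> x \<longrightarrow> t \<in> a \<longrightarrow> (u \<in> g a \<longleftrightarrow> u \<in> g x)"
proof (cases "u \<in> Field s")
  case True
  have "continuous_map (ray_topology r) (discrete_topology UNIV) ((\<lambda>y. u \<in> y) \<circ> g)"
    by (rule continuous_map_compose[OF g continuous_map_ray_member[OF True]])
  then have "openin (ray_topology r) {a \<in> topspace (ray_topology r). ((\<lambda>y. u \<in> y) \<circ> g) a \<in> {u \<in> g x}}"
    by (rule openin_continuous_map_preimage) simp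
  then have "openin (ray_topology r) {a \<in> rays r. u \<in> g a \<longleftrightarrow> u \<in> g x}" by simp
  then obtain F where F: "finite F"
    "\<And>a. a \<in> rays r \<Longrightarrow> \<forall>t\<in>F. t \<in> a \<longleftrightarrow> t \<in> x \<Longrightarrow> (u \<in> g a \<longleftrightarrow> u \<in> g x)"
    using ray_topology_basis[of r _ x] x by (smt (verit) mem_Collect_eq)
  obtain t where t: "t \<in> x" "\<forall>s\<in>F \<inter> x. (s, t) \<in> r"
    using ray_finite_bound[OF T x, of "F \<inter> x"] F(1) by auto
  have "u \<in> g a \<longleftrightarrow> u \<in> g x" if a: "a \<in> rays r" "a \<subseteq> x" "t \<in> a" for a
    using F(2)[OF a(1)] rayD(2)[OF a(1,3)] t(2) a(2) by blast
  then show ?thesis using t(1) by blast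
next
  case False
  have "g a \<in> rays s" if "a \<in> rays r" for a
    using continuous_map_funspace[OF g] that by auto
  then have "u \<notin> g a" if "a \<in> rays r" for a
    using that False rayD(1) by blast
  moreover obtain t where "t \<in> x" using x by (auto simp: rays_def)
  ultimately show ?thesis using x by blast
qed

lemma ray_unbounded_cofinal:
  assumes x: "x \<in> rays r" "\<not> uncountable_cofinality r x"
  obtains c where "\<And>n :: nat. c n \<in> x" "\<And>t. t \<in> x \<Longrightarrow> \<exists>n. (t, c n) \<in> r"
proof -
  obtain c :: "nat \<Rightarrow> 'a" where c: "range c \<subseteq> x" "\<And>t. t \<in> x \<Longrightarrow> \<exists>n. (c n, t) \<notin> r"
    using x(2) unfolding uncountable_cofinality_def by blast
  have "\<exists>n. (t, c n) \<in> r" if t: "t \<in> x" for t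
    using c(2)[OF t] rayD(3)[OF x(1) t] c(1) by blast
  then show ?thesis using that c(1) by blast
qed

text \<open>The node \<open>s\<close> is where \<open>q\<close> leaves \<open>p\<close>; the
  arguments below compare extensions of a ray through these nodes.\<close>

lemma ray_diff_least:
  assumes T: "is_tree r" and p: "p \<subset> q" "q \<in> rays r"
  obtains s where "s \<in> q - p" "\<And>t. t \<in> q - p \<Longrightarrow> (s, t) \<in> r"
  using ray_least[OF T p(2), of "q - p"] p(1) by blast

text \<open>If \<open>g x\<close> had a cofinal sequence, images of long initial rays would contain
  \<open>g x\<close>, properly by injectivity. An increasing sequence of initial rays is chosen so
  that each image loses the first node its predecessor had beyond \<open>g x\<close>. An image node
  of the union beyond \<open>g x\<close> would lie in almost all images, above nodes already
  lost.\<close>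

lemma uncountable_cofinality_continuous_image:
  assumes T: "is_tree r" and S: "is_tree s" and x: "x \<in> rays r" "uncountable_cofinality r x"
    and g: "continuous_map (ray_topology r) (ray_topology s) g" and inj: "inj_on g (rays r)"
  shows "uncountable_cofinality s (g x)"
proof (rule ccontr)
  let ?p = "g x"
  have gr: "g a \<in> rays s" if "a \<in> rays r" for a
    using continuous_map_funspace[OF g] that by auto
  assume "\<not> uncountable_cofinality s ?p"
  then obtain c where c: "\<And>n :: nat. c n \<in> ?p" "\<And>t. t \<in> ?p \<Longrightarrow> \<exists>n. (t, c n) \<in> s"
    using ray_unbounded_cofinal[OF gr[OF x(1)]] by blast
  obtain \<tau> where \<tau>: "\<And>u. \<tau> u \<in> x"
    "\<And>u a. a \<in> rays r \<Longrightarrow> a \<subseteq> x \<Longrightarrow> \<tau> u \<in> a \<Longrightarrow> u \<in> g a \<longleftrightarrow> u \<in> g x"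
    using continuous_map_initial_rays[OF T x(1) g] by metis
  \<comment> \<open>One \<open>t\<close> bounds the moduli of the whole cofinal sequence, so initial
    rays through \<open>t\<close> have images containing every \<open>c n\<close>.\<close>
  obtain t where t: "t \<in> x" "\<And>n. (\<tau> (c n), t) \<in> r"
    using uncountable_cofinalityD[OF x(2), of "\<lambda>n. \<tau> (c n)"] \<tau>(1) by blast
  have above: "?p \<subset> g a" if a: "a \<in> rays r" "a \<subset> x" "t \<in> a" for a
  proof -
    have "c n \<in> g a" for n
      using \<tau>(2)[OF a(1), of "c n"] a(2) rayD(2)[OF a(1,3) t(2)] c(1) by blast
    then have "?p \<subseteq> g a" using c(2) rayD(2)[OF gr[OF a(1)]] by blast
    moreover have "?p \<noteq> g a" using inj_onD[OF inj _ x(1) a(1)] a(2) by blast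
    ultimately show ?thesis by blast
  qed
  define P where "P a \<longleftrightarrow> a \<in> rays r \<and> a \<subset> x \<and> t \<in> a" for a
  \<comment> \<open>The witness \<open>\<sigma>\<close> will be the least node of
    \<open>g a - ?p\<close>; not being in \<open>g x\<close>, it is lost as soon as \<open>b\<close>
    passes its modulus.\<close>
  define Q where "Q a b \<longleftrightarrow> a \<subset> b \<and>
    (\<exists>\<sigma>. \<sigma> \<notin> g b \<and> (\<forall>\<rho> \<in> g a - ?p. (\<sigma>, \<rho>) \<in> s))" for a b
  have "\<exists>a. \<forall>n :: nat. P (a n) \<and> Q (a n) (a (Suc n))"
  proof (rule dependent_nat_choice)
    show "\<exists>a. P a" using initial_ray[OF T x t(1)] unfolding P_def by blast
    fix a assume "P a"
    then have a: "a \<in> rays r" "a \<subset> x" "t \<in> a" by (auto simp: P_def)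
    obtain \<sigma> where \<sigma>: "\<sigma> \<in> g a - ?p" "\<And>\<rho>. \<rho> \<in> g a - ?p \<Longrightarrow> (\<sigma>, \<rho>) \<in> s"
      using ray_diff_least[OF S above[OF a] gr[OF a(1)]] by blast
    obtain b where b: "b \<in> rays r" "a \<subset> b" "b \<subset> x" "\<tau> \<sigma> \<in> b"
      using extend_initial_ray[OF T x a(1,2) \<tau>(1)] by blast
    have "\<sigma> \<notin> g b" using \<tau>(2)[OF b(1) _ b(4)] b(3) \<sigma>(1) by blast
    then have "Q a b" using b(2) \<sigma>(2) unfolding Q_def by blast
    then show "\<exists>b. P b \<and> Q a b" using a(3) b unfolding P_def by blast
  qed
  then obtain a where "\<And>n :: nat. P (a n)" and Q: "\<And>n. Q (a n) (a (Suc n))" by blast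
  then have a: "\<And>n. a n \<in> rays r" "\<And>n. a n \<subset> x" "\<And>n. t \<in> a n" "\<And>n. a n \<subset> a (Suc n)"
    unfolding P_def Q_def by blast+
  note U = UN_initial_rays[where a = a, OF x a(1,2,4)]
  have "t \<in> (\<Union>n. a n)" using a(3) by blast
  then obtain \<rho> where \<rho>: "\<rho> \<in> g (\<Union>n. a n) - ?p" using above[OF U(1,2)] by blast
  obtain N where N: "\<And>n. n \<ge> N \<Longrightarrow> \<rho> \<in> g (a n)"
    using limitin_ray_member[OF U(3) g, of \<rho>] \<rho> unfolding eventually_sequentially by blast
  obtain \<sigma> where \<sigma>: "\<sigma> \<notin> g (a (Suc N))" "\<forall>\<rho> \<in> g (a N) - ?p. (\<sigma>, \<rho>) \<in> s"
    using Q[of N] unfolding Q_def by blast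
  \<comment> \<open>\<open>\<rho>\<close> lies in both \<open>g (a N)\<close> and
    \<open>g (a (Suc N))\<close>: the first puts \<open>\<sigma>\<close> below it, the second then
    forces \<open>\<sigma>\<close> into \<open>g (a (Suc N))\<close>.\<close>
  have "(\<sigma>, \<rho>) \<in> s" using \<sigma>(2) N[of N] \<rho> by blast
  moreover have "\<rho> \<in> g (a (Suc N))" using N[of "Suc N"] by simp
  ultimately show False using rayD(2)[OF gr[OF a(1)]] \<sigma>(1) by blast
qed

section \<open>Existence of rays of uncountable cofinality\<close>

text \<open>Cutting an uncountable ray just below its first node with uncountably many predecessors,
  if there is one, leaves an uncountable ray whose nodes all have countably many predecessors. A
  cofinal sequence would cover such a ray by countably many countable sets.\<close>

lemma uncountable_ray_uncountable_cofinality: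
  assumes T: "is_tree r" and x: "x \<in> rays r" "uncountable x"
  obtains x0 where "x0 \<in> rays r" "uncountable_cofinality r x0"
proof -
  have *: "uncountable_cofinality r y"
    if y: "y \<in> rays r" "uncountable y" "\<And>t. t \<in> y \<Longrightarrow> countable (under r t)" for y
  proof (rule ccontr)
    assume "\<not> uncountable_cofinality r y"
    then obtain c where c: "\<And>n :: nat. c n \<in> y" "\<And>t. t \<in> y \<Longrightarrow> \<exists>n. (t, c n) \<in> r"
      using ray_unbounded_cofinal[OF y(1)] by blast
    then have "y \<subseteq> (\<Union>n. under r (c n))" by (auto simp: under_def)
    then have "countable y" by (rule countable_subset) (use c(1) y(3) in auto)
    then show False using y(2) by blast
  qed
  show ?thesis
  proof (cases "\<exists>t\<in>x. uncountable (under r t)")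
    case False
    then have "uncountable_cofinality r x" by (intro *[OF x]) blast
    then show ?thesis by (rule that[OF x(1)])
  next
    case True
    let ?A = "{t \<in> x. uncountable (under r t)}"
    obtain m where m: "m \<in> ?A" "\<forall>a\<in>?A. (m, a) \<in> r"
      using ray_least[OF T x(1), of ?A] True by auto
    define y where "y = under r m - {m}"
    have yx: "y \<subseteq> x" using rayD(2)[OF x(1)] m(1) by (auto simp: y_def under_def)
    have yc: "countable (under r t)" if t: "t \<in> y" for t
    proof (rule ccontr)
      assume "uncountable (under r t)"
      then have "(m, t) \<in> r" using m(2) t yx by blast
      then show False using t treeD(3)[OF T] by (auto simp: y_def under_def)
    qed
    have yu: "uncountable y" using m(1) by (simp add: y_def uncountable_minus_countable)
    have "ofilter r y"
      unfolding ofilter_def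
    proof (intro conjI ballI subsetI)
      show "t \<in> Field r" if "t \<in> y" for t using that yx rayD(1)[OF x(1)] by blast
      fix t u assume t: "t \<in> y" and u: "u \<in> under r t"
      then have "(u, t) \<in> r" "(t, m) \<in> r" "t \<noteq> m" by (auto simp: y_def under_def)
      then show "u \<in> y" using treeD(2,3)[OF T] unfolding y_def under_def by blast
    qed
    moreover have "y \<in> Chains r" using yx rayD(3)[OF x(1)] by (auto simp: Chains_def)
    moreover have "\<exists>t\<in>y. (s, t) \<in> r \<and> s \<noteq> t" if s: "s \<in> y" for s
    proof (rule ccontr)
      assume "\<not> ?thesis"
      then have "t \<in> under r s" if "t \<in> y" for t
        using that rayD(3)[OF x(1), of s t] s yx treeD(1)[OF T, of s] rayD(1)[OF x(1)]
        by (fastforce simp: under_def)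
      then have "countable y" using countable_subset[OF _ yc[OF s]] by blast
      then show False using yu by blast
    qed
    moreover have "y \<noteq> {}" using yu by auto
    ultimately have "y \<in> rays r" by (simp add: rays_def)
    then show ?thesis using that *[OF _ yu yc] by blast
  qed
qed

section \<open>Convergent sequences in non-discrete ray spaces\<close>

text \<open>At a non-isolated ray \<open>y\<close> of countable cofinality, if only finitely many
  nodes sit minimally above \<open>y\<close>, rays avoiding them must leave \<open>y\<close> ever
  higher up; otherwise rays through distinct such nodes converge to \<open>y\<close>.\<close>

lemma nondiscrete_ray_topology_sequence:
  assumes T: "is_tree r" and nd: "ray_topology r \<noteq> discrete_topology (rays r)"
  obtains z y where "y \<in> rays r" "\<And>n :: nat. z n \<in> rays r" "\<And>n. z n \<noteq> y"
    "limitin (ray_topology r) z y sequentially"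
proof -
  obtain y where y: "y \<in> rays r" "\<not> openin (ray_topology r) {y}"
    using nd discrete_topology_unique[of "rays r" "ray_topology r"] by auto
  have near: "\<exists>z\<in>rays r. z \<noteq> y \<and> (\<forall>t\<in>F. t \<in> z \<longleftrightarrow> t \<in> y)" if F: "finite F" "F \<subseteq> Field r" for F
  proof (rule ccontr)
    assume "\<not> ?thesis"
    then have "{z \<in> rays r. \<forall>t\<in>F. t \<in> z \<longleftrightarrow> t \<in> y} = {y}" using y(1) by blast
    then show False using openin_ray_cylinder[OF F, of y] y(2) by simp
  qed
  show ?thesis
  proof (cases "uncountable_cofinality r y")
    case True
    \<comment> \<open>In this case the limit is not \<open>y\<close> but the union of an increasing
      sequence of initial rays of \<open>y\<close>.\<close>
    define P where "P a \<longleftrightarrow> a \<in> rays r \<and> a \<subset> y" for a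
    obtain t where t: "t \<in> y" using y by (auto simp: rays_def)
    have "\<exists>a. \<forall>n :: nat. P (a n) \<and> a n \<subset> a (Suc n)"
    proof (rule dependent_nat_choice)
      show "\<exists>a. P a" using initial_ray[OF T y(1) True t] unfolding P_def by blast
      fix a assume "P a"
      then show "\<exists>b. P b \<and> a \<subset> b"
        using extend_initial_ray[OF T y(1) True _ _ t] unfolding P_def by metis
    qed
    then obtain a where "\<forall>n :: nat. P (a n) \<and> a n \<subset> a (Suc n)" ..
    then have a: "a n \<in> rays r" "a n \<subset> y" "a n \<subset> a (Suc n)" for n
      by (simp_all add: P_def)
    note U = UN_initial_rays[where a = a, OF y(1) True a]
    have "a n \<noteq> (\<Union>n. a n)" for n using a(3)[of n] by blast
    then show ?thesis using that[OF U(1) a(1) _ U(3)] by blast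
  next
    case False
    then obtain c where c: "\<And>n :: nat. c n \<in> y" "\<And>t. t \<in> y \<Longrightarrow> \<exists>n. (t, c n) \<in> r"
      using ray_unbounded_cofinal[OF y(1)] by blast
    \<comment> \<open>The tops of \<open>y\<close>: first nodes beyond \<open>y\<close> on rays
      properly extending it.\<close>
    define top where "top z s \<longleftrightarrow> z \<in> rays r \<and> y \<subset> z \<and> s \<in> z - y \<and> (\<forall>t\<in>z - y. (s, t) \<in> r)" for z s
    let ?U = "{s. \<exists>z. top z s}"
    show ?thesis
    proof (cases "finite ?U")
      case True
      have "?U \<subseteq> Field r" using rayD(1) unfolding top_def by blast
      moreover have cF: "c n \<in> Field r" for n using c(1) rayD(1)[OF y(1)] by blast
      \<comment> \<open>Agreement with \<open>y\<close> on \<open>?U\<close> excludes all extensions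
        of \<open>y\<close>; agreement on \<open>c 0\<close> to \<open>c n\<close> gives convergence
        on \<open>y\<close> as \<open>n\<close> grows.\<close>
      ultimately have "\<exists>z\<in>rays r. z \<noteq> y \<and> (\<forall>t\<in>?U \<union> c ` {..n}. t \<in> z \<longleftrightarrow> t \<in> y)" for n
        using True by (intro near) auto
      then obtain z where z: "\<And>n. z n \<in> rays r" "\<And>n. z n \<noteq> y"
        "\<And>n t. t \<in> ?U \<union> c ` {..n} \<Longrightarrow> t \<in> z n \<longleftrightarrow> t \<in> y"
        by metis
      have cz: "c k \<in> z n" if "k \<le> n" for k n using z(3)[of "c k" n] c(1) that by blast
      have nsub: "\<not> y \<subseteq> z n" for n
      proof
        assume "y \<subseteq> z n"
        then have yz: "y \<subset> z n" using z(2)[of n] by blast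
        obtain s where "s \<in> z n - y" "\<And>t. t \<in> z n - y \<Longrightarrow> (s, t) \<in> r"
          using ray_diff_least[OF T yz z(1)] by blast
        then have "top (z n) s" using z(1) yz by (simp add: top_def)
        then show False using z(3)[of s n] unfolding top_def by blast
      qed
      have "limitin (ray_topology r) z y sequentially"
      proof (rule limitin_ray_topologyI[OF y(1) z(1)])
        fix t assume "t \<in> Field r"
        show "\<forall>\<^sub>F n in sequentially. t \<in> z n \<longleftrightarrow> t \<in> y"
        proof (cases "t \<in> y")
          case True
          then obtain k where "(t, c k) \<in> r" using c(2) by blast
          then have "t \<in> z n" if "n \<ge> k" for n using rayD(2)[OF z(1) cz[OF that]] by blast
          then show ?thesis using True unfolding eventually_sequentially by blast
        next
          case t: False
          \<comment> \<open>Unless \<open>t\<close> is in no \<open>z n\<close>, some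
            \<open>c k\<close> is not below \<open>t\<close>; then a \<open>z n\<close> containing
            both would place \<open>t\<close> below \<open>c k\<close>, hence in
            \<open>y\<close>.\<close>
          have "\<exists>k. (c k, t) \<notin> r" if "t \<in> z n" for n
          proof (rule ccontr)
            assume "\<nexists>k. (c k, t) \<notin> r"
            then have "y \<subseteq> z n" using rayD(2)[OF z(1)] that c(2) by blast
            then show False using nsub by blast
          qed
          then consider "\<forall>n. t \<notin> z n" | k where "(c k, t) \<notin> r" by blast
          then show ?thesis
          proof cases
            case 1 then show ?thesis using t by simp
          next
            case 2
            have "t \<notin> z n" if n: "n \<ge> k" for n
              using rayD(3)[OF z(1) cz[OF n]] rayD(2)[OF y(1) c(1)] 2 t by blast
            then show ?thesis using t unfolding eventually_sequentially by blast
          qed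
        qed
      qed
      then show ?thesis by (rule that[where z = z, OF y(1) z(1,2)])
    next
      case False
      then obtain s :: "nat \<Rightarrow> 'a" where s: "inj s" "range s \<subseteq> ?U"
        using infinite_countable_subset by blast
      then have "\<forall>n. \<exists>z. top z (s n)" by blast
      then obtain z where z: "\<And>n. top (z n) (s n)" by metis
      have "limitin (ray_topology r) z y sequentially"
      proof (rule limitin_ray_topologyI)
        fix t assume "t \<in> Field r"
        show "\<forall>\<^sub>F n in sequentially. t \<in> z n \<longleftrightarrow> t \<in> y"
        proof (cases "t \<in> y")
          case True
          then have "\<forall>n. t \<in> z n" using z unfolding top_def by blast
          then show ?thesis using True by simp
        next
          case t: False
          \<comment> \<open>A node \<open>t\<close> outside \<open>y\<close> lies in at most one
            \<open>z n\<close>: membership in \<open>z n\<close> and \<open>z m\<close> puts both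
            tops below \<open>t\<close>, and minimality in each ray makes them equal.\<close>
          have le: "(s n, s m) \<in> r" if "t \<in> z n" "t \<in> z m" for n m
          proof -
            have "(s m, t) \<in> r" using z[of m] that t unfolding top_def by blast
            then have "s m \<in> z n" using rayD(2)[of "z n" r t "s m"] z[of n] that unfolding top_def by blast
            then show ?thesis using z[of n] z[of m] unfolding top_def by blast
          qed
          have "n = m" if "t \<in> z n" "t \<in> z m" for n m
            using treeD(3)[OF T le[OF that] le[OF that(2,1)]] injD[OF s(1)] by blast
          then have "\<exists>N. \<forall>n\<ge>N. t \<notin> z n" by (metis Suc_n_not_le_n)
          then show ?thesis using t unfolding eventually_sequentially by blast
        qed
      qed (use y z in \<open>auto simp: top_def\<close>)
      then show ?thesis using that[OF y(1), of z] z unfolding top_def by blast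
    qed
  qed
qed

section \<open>The product with a convergent sequence does not embed\<close>

text \<open>
  With \<open>p = h (x, y)\<close>, almost all rays \<open>h (x, z n)\<close> end-extend \<open>p\<close> through nodes \<open>\<sigma> n\<close> minimal
  outside \<open>p\<close>; these lie in \<open>h (a, z n)\<close> for a fixed proper initial segment \<open>a\<close> of \<open>x\<close>, which
  forces \<open>h (a, y) = p\<close>.
\<close>

lemma ray_product_not_embeddable:
  assumes T: "is_tree r" and S: "is_tree s"
    and x: "x \<in> rays r" "uncountable_cofinality r x"
    and z: "limitin X z y sequentially" "\<And>n :: nat. z n \<in> topspace X" "\<And>n. z n \<noteq> y"
    and h: "continuous_map (prod_topology (ray_topology r) X) (ray_topology s) h"
    and inj: "inj_on h (rays r \<times> topspace X)"
  shows False
proof -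
  define p where "p = h (x, y)"
  have y: "y \<in> topspace X" using z(1) by (simp add: limitin_def)
  have hr: "h (a, w) \<in> rays s" if "a \<in> rays r" "w \<in> topspace X" for a w
    using continuous_map_funspace[OF h] that by auto
  have h1: "continuous_map (ray_topology r) (ray_topology s) (\<lambda>a. h (a, w))" if "w \<in> topspace X" for w
  proof -
    have "continuous_map (ray_topology r) (prod_topology (ray_topology r) X) (\<lambda>a. (a, w))"
      using that by (simp add: continuous_map_pairedI)
    from continuous_map_compose[OF this h] show ?thesis by (simp add: o_def)
  qed
  have h2: "continuous_map X (ray_topology s) (\<lambda>w. h (a, w))" if "a \<in> rays r" for a
  proof -
    have "continuous_map X (prod_topology (ray_topology r) X) (\<lambda>w. (a, w))"
      using that by (simp add: continuous_map_pairedI)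
    from continuous_map_compose[OF this h] show ?thesis by (simp add: o_def)
  qed
  have pr: "p \<in> rays s" using hr x(1) y by (simp add: p_def)
  have "inj_on (\<lambda>a. h (a, y)) (rays r)" using inj y unfolding inj_on_def by blast
  then have pc: "uncountable_cofinality s p"
    using uncountable_cofinality_continuous_image[OF T S x h1[OF y]] by (simp add: p_def)
  let ?p = "\<lambda>n. h (x, z n)"
  have pn: "?p n \<in> rays s" for n using hr x(1) z(2) by blast
  have pnp: "?p n \<noteq> p" for n
    using inj_onD[OF inj, of "(x, z n)" "(x, y)"] x(1) y z(2,3) by (auto simp: p_def)
  have lim: "\<forall>\<^sub>F n in sequentially. u \<in> ?p n \<longleftrightarrow> u \<in> p" for u
    using limitin_ray_member[OF z(1) h2[OF x(1)]] by (simp add: p_def)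
  obtain p0 where p0: "p0 \<in> p" using pr by (auto simp: rays_def)
  \<comment> \<open>Where \<open>?p n\<close> fails to contain \<open>p\<close>, \<open>c n\<close>
    witnesses this; elsewhere \<open>p0\<close> serves as a default. A common bound \<open>u\<close>
    of all \<open>c n\<close> reduces \<open>p \<subseteq> ?p n\<close> to the single coordinate
    \<open>u \<in> ?p n\<close>.\<close>
  have "\<forall>n. \<exists>c\<in>p. \<not> p \<subseteq> ?p n \<longrightarrow> c \<notin> ?p n" using p0 by blast
  then obtain c where c: "\<And>n. c n \<in> p" "\<And>n. \<not> p \<subseteq> ?p n \<Longrightarrow> c n \<notin> ?p n" by metis
  obtain u where u: "u \<in> p" "\<And>n. (c n, u) \<in> s" using uncountable_cofinalityD[where c = c, OF pc c(1)] by metis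
  have "p \<subset> ?p n" if "u \<in> ?p n" for n
    using c(2)[of n] rayD(2)[OF pn that u(2)] pnp[of n] by blast
  then have "\<forall>\<^sub>F n in sequentially. p \<subset> ?p n"
    by (intro eventually_mono[OF lim[of u]]) (use u(1) in blast)
  then obtain n0 where n0: "\<And>n. n \<ge> n0 \<Longrightarrow> p \<subset> ?p n" unfolding eventually_sequentially by blast
  have "\<exists>\<sigma>. n \<ge> n0 \<longrightarrow> \<sigma> \<in> ?p n - p \<and> (\<forall>t\<in>?p n - p. (\<sigma>, t) \<in> s)" for n
    using ray_diff_least[OF S n0 pn] by metis
  then obtain \<sigma> where \<sigma>: "\<And>n. n \<ge> n0 \<Longrightarrow> \<sigma> n \<in> ?p n - p"
    "\<And>n t. n \<ge> n0 \<Longrightarrow> t \<in> ?p n - p \<Longrightarrow> (\<sigma> n, t) \<in> s" by metis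
  have "\<exists>t\<in>x. \<forall>a\<in>rays r. a \<subseteq> x \<longrightarrow> t \<in> a \<longrightarrow> (\<sigma> n \<in> h (a, z n) \<longleftrightarrow> \<sigma> n \<in> ?p n)" for n
    using continuous_map_initial_rays[OF T x(1) h1[OF z(2)]] .
  then obtain \<tau> where \<tau>: "\<And>n. \<tau> n \<in> x"
    "\<And>n a. a \<in> rays r \<Longrightarrow> a \<subseteq> x \<Longrightarrow> \<tau> n \<in> a \<Longrightarrow> (\<sigma> n \<in> h (a, z n) \<longleftrightarrow> \<sigma> n \<in> ?p n)"
    by metis
  \<comment> \<open>The moduli for all \<open>n\<close> have a common bound in \<open>x\<close>, so
    one proper initial ray \<open>a\<close> keeps every \<open>\<sigma> n\<close> with
    \<open>n \<ge> n0\<close> in \<open>h (a, z n)\<close>.\<close>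
  obtain t where t: "t \<in> x" "\<And>n. (\<tau> n, t) \<in> r" using uncountable_cofinalityD[where c = \<tau>, OF x(2) \<tau>(1)] by metis
  obtain a where a: "a \<in> rays r" "a \<subset> x" "t \<in> a" using initial_ray[OF T x t(1)] by blast
  let ?w = "\<lambda>n. h (a, z n)" and ?q = "h (a, y)"
  have w: "?w n \<in> rays s" for n using hr a(1) z(2) by blast
  have q: "?q \<in> rays s" using hr a(1) y by blast
  have \<sigma>w: "\<sigma> n \<in> ?w n" if "n \<ge> n0" for n
    using \<tau>(2)[OF a(1), of n] a(2) rayD(2)[OF a(1,3) t(2)] \<sigma>(1)[OF that] by blast
  have pw: "p \<subseteq> ?w n" if n: "n \<ge> n0" for n
  proof
    fix v assume v: "v \<in> p"
    \<comment> \<open>Both nodes lie on the ray \<open>?p n\<close>, and \<open>\<sigma> n\<close>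
      below \<open>v\<close> would put \<open>\<sigma> n\<close> into \<open>p\<close>.\<close>
    then have "(v, \<sigma> n) \<in> s"
      using rayD(3)[OF pn, of v n "\<sigma> n"] rayD(2)[OF pr v] \<sigma>(1)[OF n] n0[OF n] by blast
    then show "v \<in> ?w n" using rayD(2)[OF w \<sigma>w[OF n]] by blast
  qed
  have limw: "\<forall>\<^sub>F n in sequentially. u \<in> ?w n \<longleftrightarrow> u \<in> ?q" for u
    using limitin_ray_member[OF z(1) h2[OF a(1)]] .
  have "p \<subseteq> ?q"
  proof
    fix v assume "v \<in> p"
    have "\<forall>\<^sub>F n in sequentially. v \<in> ?w n"
      unfolding eventually_sequentially using pw \<open>v \<in> p\<close> by blast
    then have "\<forall>\<^sub>F n in sequentially. v \<in> ?q" using limw[of v] by eventually_elim blast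
    then show "v \<in> ?q" by simp
  qed
  \<comment> \<open>Injectivity gives a node \<open>v\<close> of \<open>?q\<close> beyond
    \<open>p\<close>. Almost all \<open>?w n\<close> contain it, which traps the nodes
    \<open>\<sigma> n\<close> below \<open>v\<close> and so on the single ray
    \<open>?q\<close>.\<close>
  moreover have "?q \<noteq> p"
    using inj_onD[OF inj, of "(a, y)" "(x, y)"] x(1) y a by (auto simp: p_def)
  ultimately obtain v where v: "v \<in> ?q" "v \<notin> p" by blast
  obtain N where N: "\<And>n. n \<ge> N \<Longrightarrow> v \<in> ?w n"
    using limw[of v] v(1) unfolding eventually_sequentially by blast
  define M where "M = max N n0"
  have \<sigma>q: "\<sigma> n \<in> ?q" if n: "n \<ge> M" for n
  proof -
    have nn: "n \<ge> n0" "n \<ge> N" using n by (auto simp: M_def)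
    have "(\<sigma> n, v) \<in> s"
      using rayD(3)[OF w \<sigma>w[OF nn(1)] N[OF nn(2)]] rayD(2)[OF pn, of "\<sigma> n" n v]
        \<sigma>[OF nn(1)] v(2) by blast
    then show ?thesis using rayD(2)[OF q v(1)] by blast
  qed
  \<comment> \<open>Comparable on \<open>?q\<close>, two such nodes must coincide: if
    \<open>\<sigma> m\<close> is below \<open>\<sigma> n\<close>, it lies in \<open>?p n - p\<close>
    and hence above \<open>\<sigma> n\<close>.\<close>
  have le: "(\<sigma> n, \<sigma> m) \<in> s" if nm: "n \<ge> M" "m \<ge> M" for n m
  proof -
    have nn: "n \<ge> n0" "m \<ge> n0" using nm by (auto simp: M_def)
    show ?thesis
      using rayD(3)[OF q \<sigma>q[OF nm(1)] \<sigma>q[OF nm(2)]] rayD(2)[OF pn, of "\<sigma> n" n "\<sigma> m"]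
        \<sigma>(1)[OF nn(1)] \<sigma>(1)[OF nn(2)] \<sigma>(2)[OF nn(1), of "\<sigma> m"] by blast
  qed
  have eq: "\<sigma> n = \<sigma> M" if n: "n \<ge> M" for n using treeD(3)[OF S le le] n by blast
  have M: "M \<ge> n0" by (simp add: M_def)
  \<comment> \<open>The eventually constant node lies in almost all \<open>?p n\<close>, so the
    limit \<open>p\<close> contains it, although \<open>\<sigma> M\<close> was chosen outside
    \<open>p\<close>.\<close>
  have "\<sigma> M \<in> ?p n" if n: "n \<ge> M" for n using \<sigma>(1)[of n] eq[OF n] n M by auto
  then have "\<forall>\<^sub>F n in sequentially. \<sigma> M \<in> ?p n" unfolding eventually_sequentially by blast
  then have "\<forall>\<^sub>F n :: nat in sequentially. \<sigma> M \<in> p" using lim[of "\<sigma> M"] by eventually_elim blast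
  then show False using \<sigma>(1)[OF M] by simp
qed

section \<open>Disjoint copies of a tree above a new root\<close>

text \<open>\<open>None\<close> supplies the minimum that \<open>is_tree\<close> demands; the
  elements of \<open>D\<close> tag the copies, and nodes with different tags are
  incomparable.\<close>

definition copies :: "'a rel \<Rightarrow> 'd set \<Rightarrow> ('a \<times> 'd) option rel" where
  "copies r D = {(None, None)} \<union> {(None, Some (t, d)) |t d. t \<in> Field r \<and> d \<in> D} \<union>
     {(Some (s, d), Some (t, d)) |s t d. (s, t) \<in> r \<and> d \<in> D}"

definition copy :: "'a set \<Rightarrow> 'd \<Rightarrow> ('a \<times> 'd) option set" where
  "copy x d = insert None ((\<lambda>t. Some (t, d)) ` x)"

lemma in_copies [simp]:
  "(None, None) \<in> copies r D"
  "(None, Some (t, d)) \<in> copies r D \<longleftrightarrow> t \<in> Field r \<and> d \<in> D"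
  "(Some u, None) \<notin> copies r D"
  "(Some (s, e), Some (t, d)) \<in> copies r D \<longleftrightarrow> e = d \<and> d \<in> D \<and> (s, t) \<in> r"
  by (auto simp: copies_def)

lemma in_copy [simp]:
  "None \<in> copy x d"
  "Some (t, e) \<in> copy x d \<longleftrightarrow> t \<in> x \<and> e = d"
  by (auto simp: copy_def)

lemma Field_copies:
  "Field (copies r D) = insert None (Some ` (Field r \<times> D))"
proof
  show "insert None (Some ` (Field r \<times> D)) \<subseteq> Field (copies r D)"
  proof
    fix u assume u: "u \<in> insert None (Some ` (Field r \<times> D))"
    then have "(None, u) \<in> copies r D" by auto
    then show "u \<in> Field (copies r D)" by (rule FieldI2)
  qed
qed (auto simp: copies_def Field_def)

lemma under_copies:
  assumes "t \<in> Field r" "d \<in> D"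
  shows "under (copies r D) (Some (t, d)) = copy (under r t) d"
  using assms by (auto simp: under_def copies_def copy_def)

lemma is_tree_copies:
  assumes T: "is_tree r"
  shows "is_tree (copies r D)"
proof -
  let ?C = "copies r D"
  note tr = treeD[OF T]
  have rC: "(u, u) \<in> ?C" if "u \<in> Field ?C" for u
    using that tr(1) unfolding Field_copies by auto
  have tC: "(u, w) \<in> ?C" if "(u, v) \<in> ?C" "(v, w) \<in> ?C" for u v w
    using that by (auto simp: copies_def intro: FieldI2) (blast intro: tr(2))+
  have aC: "u = v" if "(u, v) \<in> ?C" "(v, u) \<in> ?C" for u v
    using that tr(3) unfolding copies_def by auto
  show ?thesis
    unfolding is_tree_def
  proof (intro conjI ballI)
    show "partial_order_on (Field ?C) ?C"
      unfolding partial_order_on_def preorder_on_def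
    proof (intro conjI)
      show "?C \<subseteq> Field ?C \<times> Field ?C" by (auto simp: Field_def)
      show "refl_on (Field ?C) ?C" using rC by (simp add: refl_on_def)
      show "trans ?C" using tC by (rule transI)
      show "antisym ?C" using aC by (rule antisymI)
    qed
    show "\<exists>m\<in>Field ?C. \<forall>t\<in>Field ?C. (m, t) \<in> ?C" unfolding Field_copies by auto
    fix u assume u: "u \<in> Field ?C"
    let ?U = "under ?C u"
    have UF: "?U \<subseteq> Field ?C" by (auto simp: under_def Field_def)
    have tot: "(a, b) \<in> ?C \<or> (b, a) \<in> ?C" if ab: "a \<in> ?U" "b \<in> ?U" for a b
    proof (cases u)
      case None
      then show ?thesis using ab by (auto simp: under_def copies_def)
    next
      case (Some v)
      then obtain t d where td: "u = Some (t, d)" "t \<in> Field r" "d \<in> D"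
        using u unfolding Field_copies by auto
      have "well_order_on (under r t) (Restr r (under r t))"
        using T td(2) by (auto simp: is_tree_def)
      then have "\<forall>a'\<in>under r t. \<forall>b'\<in>under r t. a' \<noteq> b' \<longrightarrow> (a', b') \<in> r \<or> (b', a') \<in> r"
        by (auto simp: order_on_defs total_on_def)
      then have tot': "(a', b') \<in> r \<or> (b', a') \<in> r" if "a' \<in> under r t" "b' \<in> under r t" for a' b'
        using that tr(1)[of a'] by (cases "a' = b'") (auto simp: under_def intro: FieldI1)
      have N: "(None, v) \<in> ?C" if "v \<in> ?U" for v
        using that UF unfolding Field_copies by auto
      show ?thesis
      proof (cases "a = None \<or> b = None")
        case True
        then show ?thesis using N ab by blast
      next
        case False
        have U: "?U = copy (under r t) d" using under_copies[OF td(2,3)] td(1) by simp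
        obtain a' b' where "a = Some (a', d)" "b = Some (b', d)" "a' \<in> under r t" "b' \<in> under r t"
          using False ab unfolding U copy_def by blast
        then show ?thesis using tot' td(3) by simp
      qed
    qed
    have wf: "wf (Restr ?C ?U - Id)"
    proof (rule wfI_min)
      fix q :: "('a \<times> 'b) option" and Q assume q: "q \<in> Q"
      show "\<exists>z\<in>Q. \<forall>y. (y, z) \<in> Restr ?C ?U - Id \<longrightarrow> y \<notin> Q"
      proof (cases "Q \<inter> ?U = {} \<or> None \<in> Q")
        case True
        then show ?thesis
        proof
          assume "None \<in> Q"
          then show ?thesis by (intro bexI[of _ None]) (auto simp: copies_def)
        qed (use q in blast)
      next
        case False
        then have N: "None \<notin> Q" and "Q \<inter> ?U \<noteq> {}" by simp_all
        then obtain w where w: "w \<in> Q" "w \<in> ?U" by blast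
        then have "w \<noteq> None" using N by metis
        with w have "u \<noteq> None" by (auto simp: under_def copies_def)
        then obtain t d where td: "u = Some (t, d)" "t \<in> Field r" "d \<in> D"
          using u unfolding Field_copies by auto
        have U: "?U = copy (under r t) d" using under_copies[OF td(2,3)] td(1) by simp
        have wft: "wf (Restr r (under r t) - Id)"
          using T td(2) by (auto simp: is_tree_def well_order_on_def)
        define A where "A = {s \<in> under r t. Some (s, d) \<in> Q}"
        have "A \<noteq> {}" using w U N by (auto simp: A_def copy_def)
        then obtain m where "m \<in> A" "\<forall>y. (y, m) \<in> Restr r (under r t) - Id \<longrightarrow> y \<notin> A"
          using wft unfolding wf_eq_minimal by blast
        then have m: "m \<in> under r t" "Some (m, d) \<in> Q"
          "\<And>s. s \<in> under r t \<Longrightarrow> (s, m) \<in> r \<Longrightarrow> s \<noteq> m \<Longrightarrow> Some (s, d) \<notin> Q"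
          by (auto simp: A_def)
        have "y \<notin> Q" if y: "(y, Some (m, d)) \<in> Restr ?C ?U - Id" for y
        proof (cases y)
          case None then show ?thesis using N by simp
        next
          case (Some v)
          then obtain s where "y = Some (s, d)" "s \<in> under r t" "(s, m) \<in> r" "s \<noteq> m"
            using y U by (cases v) auto
          then show ?thesis using m by blast
        qed
        then show ?thesis using m(2) by blast
      qed
    qed
    have "refl_on ?U (Restr ?C ?U)" using rC UF by (auto simp: refl_on_def)
    moreover have "trans (Restr ?C ?U)" by (intro transI) (use tC in blast)
    moreover have "antisym (Restr ?C ?U)" by (intro antisymI) (use aC in blast)
    moreover have "total_on ?U (Restr ?C ?U)" using tot by (auto simp: total_on_def)
    ultimately show "well_order_on ?U (Restr ?C ?U)" using wf unfolding order_on_defs by simp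
  qed
qed

text \<open>Having no maximum, a ray does not stop at the new root, and being a chain it stays in
  one copy.\<close>

lemma rays_copies:
  "y \<in> rays (copies r D) \<longleftrightarrow> (\<exists>x\<in>rays r. \<exists>d\<in>D. y = copy x d)"
proof
  let ?C = "copies r D"
  assume y: "y \<in> rays ?C"
  have "y \<noteq> {}" using y by (simp add: rays_def)
  then obtain u where u: "u \<in> y" by blast
  then obtain v where v: "v \<in> y" "(u, v) \<in> ?C" "u \<noteq> v" using rayD(4)[OF y] by blast
  then obtain t d where td: "v = Some (t, d)" "t \<in> Field r" "d \<in> D"
    using rayD(1)[OF y] v unfolding Field_copies by (cases v) (auto simp: copies_def)
  have None: "None \<in> y" by (rule rayD(2)[OF y v(1)]) (use td in simp)
  define x where "x = {s. Some (s, d) \<in> y}"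
  have same: "e = d" if "Some (s, e) \<in> y" for s e
    using rayD(3)[OF y that v(1)] td by auto
  have yx: "y = copy x d"
  proof (rule set_eqI)
    fix w show "w \<in> y \<longleftrightarrow> w \<in> copy x d"
      using same None by (cases w) (auto simp: x_def)
  qed
  have "x \<noteq> {}" using v(1) td by (auto simp: x_def)
  moreover have "ofilter r x"
    unfolding ofilter_def
  proof (intro conjI ballI subsetI)
    show "s \<in> Field r" if "s \<in> x" for s
      using that rayD(1)[OF y] unfolding Field_copies x_def by blast
    show "s' \<in> x" if "s \<in> x" "s' \<in> under r s" for s s'
      using that rayD(2)[OF y, of "Some (s, d)" "Some (s', d)"] td(3) by (simp add: x_def under_def)
  qed
  moreover have "x \<in> Chains r"
    using rayD(3)[OF y, of "Some (_, d)" "Some (_, d)"] by (auto simp: Chains_def x_def)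
  moreover have "\<exists>t\<in>x. (s, t) \<in> r \<and> s \<noteq> t" if s: "s \<in> x" for s
  proof -
    obtain w where "w \<in> y" "(Some (s, d), w) \<in> ?C" "Some (s, d) \<noteq> w"
      using rayD(4)[OF y, of "Some (s, d)"] s by (auto simp: x_def)
    then show ?thesis by (cases w) (auto simp: x_def)
  qed
  ultimately have "x \<in> rays r" by (simp add: rays_def)
  then show "\<exists>x\<in>rays r. \<exists>d\<in>D. y = copy x d" using td(3) yx by blast
next
  let ?C = "copies r D"
  assume "\<exists>x\<in>rays r. \<exists>d\<in>D. y = copy x d"
  then obtain x d where x: "x \<in> rays r" and d: "d \<in> D" and y: "y = copy x d" by blast
  obtain x0 where x0: "x0 \<in> x" using x by (auto simp: rays_def)
  have "ofilter ?C y"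
    unfolding ofilter_def
  proof (intro conjI ballI subsetI)
    show "u \<in> Field ?C" if "u \<in> y" for u
      using that rayD(1)[OF x] d unfolding Field_copies y copy_def by auto
    fix u v assume u: "u \<in> y" and v: "v \<in> under ?C u"
    show "v \<in> y"
    proof (cases v)
      case (Some w)
      then obtain s e where v': "v = Some (s, e)" by (cases w) simp
      then obtain t where "u = Some (t, d)" "t \<in> x"
        using u v unfolding y copy_def under_def by auto
      then have "(s, t) \<in> r" "e = d" using v v' by (auto simp: under_def)
      then show ?thesis using rayD(2)[OF x \<open>t \<in> x\<close>] v' y by simp
    qed (simp add: y)
  qed
  moreover have "y \<in> Chains ?C"
    using rayD(1,3)[OF x] d unfolding Chains_def y copy_def by auto
  moreover have "\<exists>v\<in>y. (u, v) \<in> ?C \<and> u \<noteq> v" if u: "u \<in> y" for u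
  proof (cases u)
    case None
    then show ?thesis using x0 rayD(1)[OF x] d y by (intro bexI[of _ "Some (x0, d)"]) auto
  next
    case (Some w)
    then obtain s where s: "u = Some (s, d)" "s \<in> x" using u y by (cases w) simp
    then obtain t where "t \<in> x" "(s, t) \<in> r" "s \<noteq> t" using rayD(4)[OF x] by blast
    then show ?thesis using s d y by (intro bexI[of _ "Some (t, d)"]) auto
  qed
  moreover have "y \<noteq> {}" by (auto simp: y copy_def)
  ultimately show "y \<in> rays ?C" by (simp add: rays_def)
qed

text \<open>The inverse is continuous since the rays of copy \<open>d\<close> are those through its
  root \<open>Some (m, d)\<close>, an open condition, and there the tag is constant. Discreteness of
  the second factor serves the forward direction, where membership of \<open>Some (t, e)\<close>
  tests the tag for equality with \<open>e\<close>.\<close>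

lemma prod_discrete_homeomorphic_copies:
  assumes T: "is_tree r"
  shows "prod_topology (ray_topology r) (discrete_topology D) homeomorphic_space
    ray_topology (copies r D)"
proof -
  let ?P = "prod_topology (ray_topology r) (discrete_topology D)" and ?C = "copies r D"
  let ?B = "discrete_topology (UNIV :: bool set)"
  \<comment> \<open>The description of the tag is meaningful on a ray, which contains nodes beyond
    the new root, all in one copy.\<close>
  define k where "k y = ({t. \<exists>d. Some (t, d) \<in> y}, THE d. \<exists>t. Some (t, d) \<in> y)"
    for y :: "('a \<times> 'b) option set"
  have kcopy: "k (copy x d) = (x, d)" if "x \<in> rays r" for x d
  proof -
    obtain t where "t \<in> x" using \<open>x \<in> rays r\<close> by (auto simp: rays_def)
    then show ?thesis by (auto simp: k_def intro!: the_equality)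
  qed
  obtain m where m: "m \<in> Field r" "\<forall>t\<in>Field r. (m, t) \<in> r" using T by (auto simp: is_tree_def)
  have mx: "m \<in> x" if x: "x \<in> rays r" for x
  proof -
    obtain t where t: "t \<in> x" using x by (auto simp: rays_def)
    then have "(m, t) \<in> r" using m(2) rayD(1)[OF x] by blast
    then show ?thesis using rayD(2)[OF x t] by blast
  qed
  have "homeomorphic_maps ?P (ray_topology ?C) (\<lambda>(x, d). copy x d) k"
    unfolding homeomorphic_maps_def
  proof (intro conjI ballI)
    show "continuous_map ?P (ray_topology ?C) (\<lambda>(x, d). copy x d)"
    proof (rule continuous_map_into_ray_topology)
      show "(\<lambda>(x, d). copy x d) \<in> topspace ?P \<rightarrow> rays ?C" by (fastforce simp: rays_copies)
      fix u assume u: "u \<in> Field ?C"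
      show "continuous_map ?P ?B (\<lambda>p. u \<in> (case p of (x, d) \<Rightarrow> copy x d))"
      proof (cases u)
        case None
        then show ?thesis by (simp add: case_prod_beta)
      next
        case (Some v)
        then obtain t e where u': "u = Some (t, e)" "t \<in> Field r"
          using u unfolding Field_copies by auto
        have "continuous_map ?P ?B ((\<lambda>x. t \<in> x) \<circ> fst)"
          by (intro continuous_map_compose[OF continuous_map_fst] continuous_map_ray_member u'(2))
        moreover have "continuous_map ?P ?B ((\<lambda>d. e = d) \<circ> snd)"
          by (rule continuous_map_compose[OF continuous_map_snd]) simp
        ultimately have "continuous_map ?P (prod_topology ?B ?B) (\<lambda>p. (t \<in> fst p, e = snd p))"
          by (intro continuous_map_pairedI) (simp_all add: o_def)
        then have "continuous_map ?P (discrete_topology UNIV) (\<lambda>p. (t \<in> fst p, e = snd p))"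
          by (simp flip: prod_topology_discrete_topology)
        then have "continuous_map ?P ?B ((\<lambda>(a, b). a \<and> b) \<circ> (\<lambda>p. (t \<in> fst p, e = snd p)))"
          by (rule continuous_map_compose) simp
        then show ?thesis by (simp add: u' case_prod_beta o_def)
      qed
    qed
    show "continuous_map (ray_topology ?C) ?P k"
    proof (rule pasting_lemma)
      fix d assume d: "d \<in> D"
      let ?E = "{y \<in> rays ?C. Some (m, d) \<in> y}"
      have sF: "Some (t, d) \<in> Field ?C" if "t \<in> Field r" for t
        using that d unfolding Field_copies by blast
      have "openin (ray_topology ?C) {y \<in> topspace (ray_topology ?C). (Some (m, d) \<in> y) \<in> {True}}"
        by (rule openin_continuous_map_preimage[OF continuous_map_ray_member[OF sF[OF m(1)]]]) simp
      then show "openin (ray_topology ?C) ?E" by simp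
      show "continuous_map (subtopology (ray_topology ?C) ?E) ?P (\<lambda>y. ({t. Some (t, d) \<in> y}, d))"
      proof (rule continuous_map_pairedI)
        show "continuous_map (subtopology (ray_topology ?C) ?E) (ray_topology r) (\<lambda>y. {t. Some (t, d) \<in> y})"
        proof (rule continuous_map_into_ray_topology)
          show "(\<lambda>y. {t. Some (t, d) \<in> y}) \<in> topspace (subtopology (ray_topology ?C) ?E) \<rightarrow> rays r"
            by (auto simp: rays_copies)
          fix t assume "t \<in> Field r"
          then show "continuous_map (subtopology (ray_topology ?C) ?E) ?B (\<lambda>y. t \<in> {t. Some (t, d) \<in> y})"
            using continuous_map_from_subtopology[OF continuous_map_ray_member[OF sF]] by simp
        qed
      qed (use d in simp)
      fix e y assume "e \<in> D" "y \<in> topspace (ray_topology ?C) \<inter> ?E \<inter> {y \<in> rays ?C. Some (m, e) \<in> y}"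
      then have y: "y \<in> rays ?C" "Some (m, d) \<in> y" "Some (m, e) \<in> y" by simp_all
      then obtain x d' where "y = copy x d'" using iffD1[OF rays_copies y(1)] by blast
      then have "d = e" using y(2,3) by simp
      then show "({t. Some (t, d) \<in> y}, d) = ({t. Some (t, e) \<in> y}, e)" by simp
    next
      fix y assume "y \<in> topspace (ray_topology ?C)"
      then show "\<exists>d. d \<in> D \<and> y \<in> {y \<in> rays ?C. Some (m, d) \<in> y} \<and> k y = ({t. Some (t, d) \<in> y}, d)"
        using kcopy mx by (auto simp: rays_copies)
    qed
  next
    fix p assume "p \<in> topspace ?P"
    then show "k (case p of (x, d) \<Rightarrow> copy x d) = p" using kcopy by auto
  next
    fix y assume "y \<in> topspace (ray_topology ?C)"
    then show "(case k y of (x, d) \<Rightarrow> copy x d) = y" using kcopy by (auto simp: rays_copies)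
  qed
  then show ?thesis unfolding homeomorphic_space_def by blast
qed

section \<open>The equivalence\<close>

theorem theorem6p9:
  fixes T :: "'a rel" and T' :: "'b rel"
  assumes "is_tree T" and "pruned T" and "\<exists>x\<in>rays T. uncountable x"
    and "is_tree T'"
  shows "ray_topology T' = discrete_topology (rays T') \<longleftrightarrow>
         ray_space (prod_topology (ray_topology T) (ray_topology T'))"
proof
  assume "ray_topology T' = discrete_topology (rays T')"
  \<comment> \<open>The rays of \<open>T'\<close> themselves serve as tags: one copy of
    \<open>T\<close> for each.\<close>
  then have "prod_topology (ray_topology T) (ray_topology T') homeomorphic_space
      ray_topology (copies T (rays T'))"
    using prod_discrete_homeomorphic_copies[OF assms(1), of "rays T'"] by simp
  then show "ray_space (prod_topology (ray_topology T) (ray_topology T'))"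
    by (rule ray_spaceI[OF is_tree_copies[OF assms(1)]])
next
  let ?X = "prod_topology (ray_topology T) (ray_topology T')"
  assume "ray_space ?X"
  then obtain S :: "(('a set \<times> 'b set) \<times> nat) rel" and h
    where S: "is_tree S" and h: "homeomorphic_map ?X (ray_topology S) h"
    unfolding ray_space_def homeomorphic_space by blast
  have inj: "inj_on h (rays T \<times> topspace (ray_topology T'))"
    using homeomorphic_imp_injective_map[OF h] by simp
  obtain x where x: "x \<in> rays T" "uncountable_cofinality T x"
    using uncountable_ray_uncountable_cofinality[OF assms(1)] assms(3) by blast
  show "ray_topology T' = discrete_topology (rays T')"
  proof (rule ccontr)
    assume nd: "ray_topology T' \<noteq> discrete_topology (rays T')"
    obtain z y where z: "\<And>n :: nat. z n \<in> rays T'" "\<And>n. z n \<noteq> y"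
      "limitin (ray_topology T') z y sequentially"
      using nondiscrete_ray_topology_sequence[OF assms(4) nd] by metis
    show False
      by (rule ray_product_not_embeddable[OF assms(1) S x z(3) _ z(2)
            homeomorphic_imp_continuous_map[OF h] inj]) (simp add: z(1))
  qed
qed

end
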